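(* Let $A$ generate a $C_0$-semigroup $(T(t))_{t\ge 0}$ on a Banach space $X$, put $\alpha:=\limsup_{t\to 0}\|T(t)\|$, and let $K:[0,\infty)\times X\to X$ be jointly continuous and map bounded sets to precompact sets. Let $B\subset X$ be a bounded set. Assume that for every $x_0\in B$ there exists a global mild solution $x(t,x_0)$, $t\in[0,\infty)$, of $$x'(t)=Ax(t)+K(t,x(t)),\quad t\ge 0,\qquad x(0)=x_0, \qquad ( * )$$ such that for each $\tau>0$ the set $S(\tau,B)=\{x(t,x_0):\ 0\le t\le \tau,\ x_0\in B\}$ is bounded. Let $a:[0,\infty)\to[0,\infty)$ be non-increasing with $\lim_{t\to\infty}a(t)=0$, and let $r>0$, $y\in B$ and $t_0=t_0(r)\ge 0$ be such that $a(t_0)<\frac{r}{2\alpha}$ and $\overline{B}(y,r)\subset B$. (i) Assume that for some $\omega\in\mathbb R$ the resolvent $(\omega+ib-A)^{-1}$ is well-defined for all $b\in\mathbb R$ and unbounded in $b\in\mathbb R$. Then there exist $x_0\in\overline{B}(y,r)$ and a mild solution $x(t,x_0)$ of $( * )$ such that $$\|x(t,x_0)\|\ge a(t)e^{\omega t},\qquad t\ge t_0.$$ (ii) In any case, there exist $x_0\in\overline{B}(y,r)$ and a mild solution $x(t,x_0)$ of $( * )$ such that $$\|x(t,x_0)\|\ge a(t)e^{s_e(A)t},\qquad t\ge t_0.$$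
   Context: All Banach spaces are complex and infinite-dimensional. $\overline{B}(y,r)=\{x\in X:\|x-y\|\le r\}$. A global mild solution of $( * )$ is a continuous $x:[0,\infty)\to X$ with $x(t)=T(t)x_0+\int_0^tT(t-s)K(s,x(s))\,ds$ for all $t\ge0$. Uniqueness of mild solutions is not assumed. The essential spectrum of a closed, densely defined operator $A$ is $\sigma_e(A)=\{\lambda\in\mathbb C:\lambda-A \text{ is not Fredholm}\}$, and $s_e(A)=\sup\{\operatorname{Re}\lambda:\lambda\in\sigma_e(A)\}$ (with $\sup\emptyset=-\infty$, and $e^{s_e(A)t}$ read as $0$ for all $t\ge0$ if $s_e(A)=-\infty$). *)

theory Defs
  imports "HOL-Analysis.Analysis"
begin

section \<open>Complex Banach spaces\<close>

class complex_banach = banach +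
  fixes scaleC :: "complex \<Rightarrow> 'a \<Rightarrow> 'a"  (infixr "*\<^sub>C" 75)
  assumes scaleC_add_right: "c *\<^sub>C (x + y) = c *\<^sub>C x + c *\<^sub>C y"
    and scaleC_add_left: "(c + d) *\<^sub>C x = c *\<^sub>C x + d *\<^sub>C x"
    and scaleC_scaleC: "c *\<^sub>C (d *\<^sub>C x) = (c * d) *\<^sub>C x"
    and scaleC_one: "1 *\<^sub>C x = x"
    and scaleC_of_real: "complex_of_real r *\<^sub>C x = r *\<^sub>R x"
    and norm_scaleC: "norm (c *\<^sub>C x) = cmod c * norm x"

global_interpretation complex_vector: vector_space "scaleC :: complex \<Rightarrow> 'a \<Rightarrow> 'a::complex_banach"
  by standard (simp_all add: scaleC_add_right scaleC_add_left scaleC_scaleC scaleC_one)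

definition finite_dim :: "'a::complex_banach set \<Rightarrow> bool" where
  "finite_dim V \<longleftrightarrow> (\<exists>F. finite F \<and> complex_vector.span F = V)"

definition finite_codim :: "'a::complex_banach set \<Rightarrow> bool" where
  "finite_codim V \<longleftrightarrow> (\<exists>F. finite F \<and> {v + w |v w. v \<in> V \<and> w \<in> complex_vector.span F} = UNIV)"


section \<open>Strongly continuous semigroups and their generators\<close>

text \<open>Elements of \<^typ>\<open>'a \<Rightarrow>\<^sub>L 'a\<close> are only bounded and real-linear, so homogeneity over the
  complex numbers is required separately. Values at negative times are irrelevant.\<close>

definition C0_semigroup :: "(real \<Rightarrow> 'a::complex_banach \<Rightarrow>\<^sub>L 'a) \<Rightarrow> bool" where
  "C0_semigroup T \<longleftrightarrow>
     (\<forall>t\<ge>0. \<forall>c x. T t (c *\<^sub>C x) = c *\<^sub>C T t x) \<and>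
     T 0 = id_blinfun \<and>
     (\<forall>s\<ge>0. \<forall>t\<ge>0. T (s + t) = T s o\<^sub>L T t) \<and>
     (\<forall>x. ((\<lambda>t. T t x) \<longlongrightarrow> x) (at_right 0))"

text \<open>An unbounded operator is a domain \<open>D\<close> together with a function \<open>A\<close> whose values
  outside \<open>D\<close> are irrelevant.\<close>

definition generates ::
  "'a::complex_banach set \<Rightarrow> ('a \<Rightarrow> 'a) \<Rightarrow> (real \<Rightarrow> 'a \<Rightarrow>\<^sub>L 'a) \<Rightarrow> bool" where
  "generates D A T \<longleftrightarrow>
     C0_semigroup T \<and>
     D = {x. \<exists>z. ((\<lambda>h. (1 / h) *\<^sub>R (T h x - x)) \<longlongrightarrow> z) (at_right 0)} \<and>
     (\<forall>x\<in>D. ((\<lambda>h. (1 / h) *\<^sub>R (T h x - x)) \<longlongrightarrow> A x) (at_right 0))"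


section \<open>Resolvent and essential spectrum\<close>

definition resolvent ::
  "'a::complex_banach set \<Rightarrow> ('a \<Rightarrow> 'a) \<Rightarrow> complex \<Rightarrow> 'a \<Rightarrow> 'a" where
  "resolvent D A \<mu> = inv_into D (\<lambda>x. \<mu> *\<^sub>C x - A x)"

definition resolvent_set :: "'a::complex_banach set \<Rightarrow> ('a \<Rightarrow> 'a) \<Rightarrow> complex set" where
  "resolvent_set D A =
     {\<mu>. bij_betw (\<lambda>x. \<mu> *\<^sub>C x - A x) D UNIV \<and> bounded_linear (resolvent D A \<mu>)}"

text \<open>To be used for closed, densely defined, complex-linear operators only, such as
  generators; closedness and density of the domain are not repeated here.\<close>

definition fredholm :: "'a::complex_banach set \<Rightarrow> ('a \<Rightarrow> 'a) \<Rightarrow> bool" where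
  "fredholm D A \<longleftrightarrow> finite_dim {x \<in> D. A x = 0} \<and> closed (A ` D) \<and> finite_codim (A ` D)"

definition essential_spectrum :: "'a::complex_banach set \<Rightarrow> ('a \<Rightarrow> 'a) \<Rightarrow> complex set" where
  "essential_spectrum D A = {\<mu>. \<not> fredholm D (\<lambda>x. \<mu> *\<^sub>C x - A x)}"

definition essential_bound :: "'a::complex_banach set \<Rightarrow> ('a \<Rightarrow> 'a) \<Rightarrow> ereal" where
  "essential_bound D A = (SUP \<mu>\<in>essential_spectrum D A. ereal (Re \<mu>))"

text \<open>The exponential \<open>exp (s t)\<close>, read as \<open>0\<close> for all \<open>t\<close> (including \<open>t = 0\<close>) if
  \<open>s = -\<infinity>\<close>. The value at \<open>s = \<infinity>\<close> is a dummy: for a generator, \<^const>\<open>essential_bound\<close> is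
  never \<open>\<infinity>\<close>.\<close>

definition exp_rate :: "ereal \<Rightarrow> real \<Rightarrow> real" where
  "exp_rate s t = (if s = -\<infinity> then 0 else exp (real_of_ereal s * t))"


section \<open>Mild solutions\<close>

text \<open>The integrand is continuous on \<open>{0..t}\<close> whenever \<open>T\<close> is a \<open>C\<^sub>0\<close>-semigroup, \<open>K\<close> is
  jointly continuous and \<open>u\<close> is continuous, so the integral exists and is the Riemann integral.\<close>

definition mild_solution ::
  "(real \<Rightarrow> 'a::complex_banach \<Rightarrow>\<^sub>L 'a) \<Rightarrow> (real \<Rightarrow> 'a \<Rightarrow> 'a) \<Rightarrow> 'a \<Rightarrow> (real \<Rightarrow> 'a) \<Rightarrow> bool" where
  "mild_solution T K x0 u \<longleftrightarrow>
     continuous_on {0..} u \<and>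
     (\<forall>t\<ge>0. u t = T t x0 + integral {0..t} (\<lambda>s. T (t - s) (K s (u s))))"

text \<open>In a complete space, precompact (totally bounded) sets are exactly those with compact
  closure.\<close>

definition maps_bounded_to_precompact :: "(real \<Rightarrow> 'a::complex_banach \<Rightarrow> 'a) \<Rightarrow> bool" where
  "maps_bounded_to_precompact K \<longleftrightarrow>
     (\<forall>S \<subseteq> {0..} \<times> UNIV. bounded S \<longrightarrow> compact (closure ((\<lambda>(t, x). K t x) ` S)))"

end

theory Submission
  imports Defs
begin

text \<open>A mild solution differs from the linear orbit \<open>T t x\<^sub>0\<close> by a Duhamel integral which, for
  bounded times and all initial values in \<open>B\<close> at once, stays in a compact set
  (\<open>mild_solution_compact_part\<close>). It therefore suffices to find a linear orbit that stays far from
  prescribed compact sets, and such an orbit is built from approximate eigenvectors of \<open>A\<close>.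

  Suppose that for some \<open>\<theta>\<close> and every compact \<open>M\<close> there are unit vectors \<open>z\<close> at distance at least
  \<open>\<theta>\<close> from \<open>M\<close> with \<open>A z \<approx> \<mu> z\<close> and \<open>Re \<mu> \<approx> \<omega>\<close> (\<open>escaping_eigenvectors\<close>). On any time interval
  \<open>[0, \<tau>]\<close> one has \<open>T t z \<approx> exp (\<mu> t) z\<close>, so that \<open>c T t z + q\<close> has norm at least about
  \<open>c \<theta> exp (\<omega> t)\<close> for all \<open>q\<close> in a given compact set (\<open>escaping_direction\<close>). The initial value is
  \<open>x\<^sub>0 = y + \<Sum>k. c\<^sub>k z\<^sub>k\<close> with \<open>c\<^sub>k\<close> decreasing geometrically, where the \<open>k\<close>-th term takes care of the
  times in \<open>[\<sigma>\<^sub>k, \<sigma>\<^sub>k\<^sub>+\<^sub>1]\<close>: the earlier terms are fixed and belong to the compact perturbation, the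
  later ones are dominated by \<open>c\<^sub>k\<close>. As \<open>a\<close> tends to \<open>0\<close>, the times \<open>\<sigma>\<^sub>k\<close> can be chosen so late
  that \<open>a \<sigma>\<^sub>k\<close> is smaller than the bound obtained from \<open>c\<^sub>k\<close> (\<open>growing_orbit\<close>).

  If the resolvent is unbounded on the line \<open>Re \<mu> = \<omega>\<close>, there are approximate eigenvectors with
  arbitrarily large imaginary part \<open>b\<close> of the eigenvalue. Their orbits turn \<open>z\<close> into \<open>-z\<close> within
  time \<open>\<pi> / \<bar>b\<bar>\<close>, while compact sets hardly move in such a short time, so these vectors escape
  (\<open>escaping_if_unbounded_resolvent\<close>).

  For the essential spectrum, let \<open>\<mu>\<close> be a point without escaping approximate eigenvectors for
  \<open>\<mu> - A\<close>, with some \<open>\<theta> < 1 / 2\<close> (\<open>trapped\<close>). Estimating Kuratowski's measure of non-compactness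
  shows that bounded sets on which \<open>\<mu> - A\<close> has precompact range are precompact, so that \<open>\<mu> - A\<close> has
  finite-dimensional kernel and closed range, and that finiteness of the codimension of the range
  does not change near \<open>\<mu>\<close> (\<open>almost_full_range_nearby\<close>). Far to the right the range is the whole
  space. Hence, if all points on the horizontal ray to the right of \<open>\<lambda>\<close> were trapped, \<open>\<lambda> - A\<close> would
  be Fredholm: every \<open>\<lambda>\<close> in the essential spectrum has a point with escaping eigenvectors on that
  ray (\<open>untrapped_right_of_essential_spectrum\<close>). The supremum of the real parts of all such points
  is finite and at least the essential bound, and the construction applies with it as \<open>\<omega>\<close>.\<close>

section \<open>Closed subspaces of complex Banach spaces\<close>

lemma bounded_bilinear_scaleC:
  "bounded_bilinear (scaleC :: complex \<Rightarrow> 'a \<Rightarrow> 'a::complex_banach)"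
proof
  fix a a' :: complex and b b' :: 'a and r :: real
  show "(a + a') *\<^sub>C b = a *\<^sub>C b + a' *\<^sub>C b" by (rule scaleC_add_left)
  show "a *\<^sub>C (b + b') = a *\<^sub>C b + a *\<^sub>C b'" by (rule scaleC_add_right)
  show "(r *\<^sub>R a) *\<^sub>C b = r *\<^sub>R (a *\<^sub>C b)"
    by (simp add: scaleC_of_real[symmetric] scaleC_scaleC scaleR_conv_of_real)
  show "a *\<^sub>C (r *\<^sub>R b) = r *\<^sub>R (a *\<^sub>C b)"
    by (simp add: scaleC_of_real[symmetric] scaleC_scaleC mult.commute)
  show "\<exists>K. \<forall>(a::complex) (b::'a). norm (a *\<^sub>C b) \<le> norm a * norm b * K"
    by (rule exI[of _ 1]) (simp add: norm_scaleC)
qed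

interpretation scaleC: bounded_bilinear
  "scaleC :: complex \<Rightarrow> 'a \<Rightarrow> 'a::complex_banach"
  by (rule bounded_bilinear_scaleC)

lemma subspace_scaleR:
  fixes x :: "'a::complex_banach"
  assumes "complex_vector.subspace V" "x \<in> V"
  shows "r *\<^sub>R x \<in> V"
  using complex_vector.subspace_scale[OF assms, of "complex_of_real r"] by (simp add: scaleC_of_real)

text \<open>The coefficient of \<open>a\<close> in a vector is bounded by the norm of the vector divided by the distance
  of \<open>a\<close> from the old span, so the coefficients along a convergent sequence converge too.\<close>

lemma closed_span_insert:
  fixes X :: "'a::complex_banach set"
  assumes cl: "closed (complex_vector.span X)"
  shows "closed (complex_vector.span (insert a X))"
proof (cases "a \<in> complex_vector.span X")
  case True
  then show ?thesis using cl by (simp add: complex_vector.span_redundant)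
next
  case False
  let ?S = "complex_vector.span X"
  define d where "d = infdist a ?S"
  have ne: "?S \<noteq> {}" using complex_vector.span_zero by blast
  have d: "d > 0"
    unfolding d_def using False cl ne in_closed_iff_infdist_zero infdist_nonneg
    by (metis less_eq_real_def)
  have coeff: "cmod c * d \<le> norm x" if "x - c *\<^sub>C a \<in> ?S" for c x
  proof (cases "c = 0")
    case True then show ?thesis by simp
  next
    case c: False
    have eq: "x = c *\<^sub>C (a - (- (1 / c)) *\<^sub>C (x - c *\<^sub>C a))"
      using c by (simp add: scaleC_scaleC complex_vector.scale_right_diff_distrib scaleC_one scaleC_add_right)
    have "(- (1 / c)) *\<^sub>C (x - c *\<^sub>C a) \<in> ?S" using that by (rule complex_vector.span_scale)
    then have "d \<le> norm (a - (- (1 / c)) *\<^sub>C (x - c *\<^sub>C a))"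
      unfolding d_def by (metis infdist_le dist_norm)
    then have "cmod c * d \<le> norm (c *\<^sub>C (a - (- (1 / c)) *\<^sub>C (x - c *\<^sub>C a)))"
      by (simp add: norm_scaleC mult_left_mono)
    then show ?thesis using eq by simp
  qed
  show ?thesis unfolding closed_sequential_limits
  proof (intro allI impI, elim conjE)
    fix x l assume "\<forall>n::nat. x n \<in> complex_vector.span (insert a X)" and lim: "x \<longlonglongrightarrow> l"
    then have "\<forall>n. \<exists>c. x n - c *\<^sub>C a \<in> ?S" by (auto simp: complex_vector.span_insert)
    then obtain c where c: "\<And>n. x n - c n *\<^sub>C a \<in> ?S" by metis
    have bd: "cmod (c m - c n) * d \<le> norm (x m - x n)" for m n
    proof (rule coeff)
      have "x m - x n - (c m - c n) *\<^sub>C a = (x m - c m *\<^sub>C a) - (x n - c n *\<^sub>C a)"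
        by (simp add: scaleC.diff_left)
      then show "x m - x n - (c m - c n) *\<^sub>C a \<in> ?S"
        using c complex_vector.span_diff by metis
    qed
    have "Cauchy c"
    proof (rule metric_CauchyI)
      fix e :: real assume "e > 0"
      then obtain N where N: "\<And>m n. m \<ge> N \<Longrightarrow> n \<ge> N \<Longrightarrow> dist (x m) (x n) < e * d"
        using metric_CauchyD[OF LIMSEQ_imp_Cauchy[OF lim], of "e * d"] d by auto
      have "dist (c m) (c n) < e" if "m \<ge> N" "n \<ge> N" for m n
      proof -
        have "cmod (c m - c n) * d < e * d"
          using bd[of m n] N[OF that] by (simp add: dist_norm)
        then show ?thesis using d by (simp add: dist_norm)
      qed
      then show "\<exists>M. \<forall>m\<ge>M. \<forall>n\<ge>M. dist (c m) (c n) < e" by blast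
    qed
    then obtain c' where c': "c \<longlonglongrightarrow> c'" using Cauchy_convergent convergent_def by blast
    have "(\<lambda>n. x n - c n *\<^sub>C a) \<longlonglongrightarrow> l - c' *\<^sub>C a"
      by (intro tendsto_diff lim scaleC.tendsto c' tendsto_const)
    then have "l - c' *\<^sub>C a \<in> ?S" 
      by (rule closed_sequentially[OF cl c])
    then show "l \<in> complex_vector.span (insert a X)" by (auto simp: complex_vector.span_insert)
  qed
qed

lemma closed_span_Un_finite:
  fixes X :: "'a::complex_banach set"
  assumes "finite F" "closed (complex_vector.span X)"
  shows "closed (complex_vector.span (X \<union> F))"
  using assms by (induction F) (auto intro: closed_span_insert)

lemma infdist_lessD:
  assumes "infdist x Y < e" "Y \<noteq> {}"
  shows "\<exists>y\<in>Y. dist x y < e"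
  using assms by (auto simp: infdist_notempty intro: cInf_lessD[of "dist x ` Y", simplified])

text \<open>F. Riesz's lemma: outside a proper closed subspace there are unit vectors at distance more than
  \<open>1 / 2\<close> from it. The factor \<open>3 / 2\<close> in the choice of \<open>y\<close> may be any number strictly between \<open>1\<close>
  and \<open>2\<close>.\<close>

lemma subspace_eq_if_half_close:
  fixes V :: "'a::complex_banach set"
  assumes V: "complex_vector.subspace V" and Y: "complex_vector.subspace Y" "closed Y" "Y \<subseteq> V"
    and half: "\<And>x. x \<in> V \<Longrightarrow> norm x \<le> 1 \<Longrightarrow> \<exists>w\<in>Y. norm (x - w) \<le> 1 / 2"
  shows "V = Y"
proof (rule ccontr)
  assume "V \<noteq> Y"
  then obtain x where x: "x \<in> V" "x \<notin> Y" using Y by blast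
  have ne: "Y \<noteq> {}" using complex_vector.subspace_0[OF Y(1)] by blast
  define d where "d = infdist x Y"
  have d: "d > 0"
    unfolding d_def using x Y ne in_closed_iff_infdist_zero infdist_nonneg
    by (metis less_eq_real_def)
  have "\<exists>y\<in>Y. dist x y < 3 / 2 * d"
    using d by (intro infdist_lessD ne) (simp add: d_def)
  then obtain y where y: "y \<in> Y" "norm (x - y) < 3 / 2 * d" by (auto simp: dist_norm)
  define s where "s = norm (x - y)"
  have s: "s > 0" using x y s_def by auto
  have "(1 / s) *\<^sub>R (x - y) \<in> V" "norm ((1 / s) *\<^sub>R (x - y)) \<le> 1"
    using x y Y V s by (auto intro!: subspace_scaleR complex_vector.subspace_diff simp: s_def)
  from half[OF this] obtain w where w: "w \<in> Y" "norm ((1 / s) *\<^sub>R (x - y) - w) \<le> 1 / 2" by blast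
  have "x - (y + s *\<^sub>R w) = s *\<^sub>R ((1 / s) *\<^sub>R (x - y) - w)"
    using s by (simp add: scaleR_right_diff_distrib)
  then have "norm (x - (y + s *\<^sub>R w)) \<le> s * (1 / 2)"
    using w s by (simp only: norm_scaleR) (simp add: mult_left_mono)
  moreover have "y + s *\<^sub>R w \<in> Y"
    using y w Y by (intro complex_vector.subspace_add subspace_scaleR)
  then have "d \<le> norm (x - (y + s *\<^sub>R w))"
    unfolding d_def by (metis infdist_le dist_norm)
  ultimately show False using y s_def d by simp
qed


section \<open>Kuratowski's measure of non-compactness\<close>

text \<open>Kuratowski's measure of non-compactness of \<open>W\<close> is the infimum of these \<open>d\<close>.\<close>

definition small_cover :: "real \<Rightarrow> 'a::metric_space set \<Rightarrow> bool" where
  "small_cover d W \<longleftrightarrow> (\<exists>P. finite P \<and> W \<subseteq> \<Union>P \<and> (\<forall>V\<in>P. \<forall>x\<in>V. \<forall>y\<in>V. dist x y \<le> d))"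

lemma small_cover_mono: "small_cover d W \<Longrightarrow> d \<le> d' \<Longrightarrow> W' \<subseteq> W \<Longrightarrow> small_cover d' W'"
  unfolding small_cover_def by (meson order_trans)

lemma small_cover_if_bounded:
  fixes W :: "'a::real_normed_vector set"
  assumes "bounded W"
  shows "\<exists>d. small_cover d W"
proof -
  obtain d where "\<forall>x\<in>W. \<forall>y\<in>W. dist x y \<le> d" using assms bounded_two_points by blast
  then show ?thesis unfolding small_cover_def by (intro exI[of _ d] exI[of _ "{W}"]) auto
qed

lemma small_cover_if_compact:
  assumes "compact M" "W \<subseteq> M" "d > 0"
  shows "small_cover d W"
proof -
  obtain k where k: "finite k" "M \<subseteq> (\<Union>x\<in>k. ball x (d / 2))"
    using assms(1,3) unfolding compact_eq_totally_bounded by (meson half_gt_zero)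
  have "dist x y \<le> d" if "x \<in> ball c (d / 2)" "y \<in> ball c (d / 2)" for x y c
    using that dist_triangle_half_r[of c x d y] by auto
  then show ?thesis
    unfolding small_cover_def using k assms(2)
    by (intro exI[of _ "(\<lambda>x. ball x (d / 2)) ` k"]) auto
qed

lemma small_cover_if_convergent:
  fixes f :: "nat \<Rightarrow> 'a::metric_space"
  assumes "f \<longlonglongrightarrow> l" "d > 0"
  shows "small_cover d (range f)"
proof -
  obtain N where N: "\<And>n. n \<ge> N \<Longrightarrow> dist (f n) l < d / 2"
    using metric_LIMSEQ_D[OF assms(1), of "d / 2"] assms(2) by auto
  let ?P = "insert (ball l (d / 2)) ((\<lambda>n. {f n}) ` {..<N})"
  have "f n \<in> \<Union>?P" for n
    using N[of n] by (cases "n < N") (auto simp: dist_commute)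
  moreover have "dist x y \<le> d" if "x \<in> ball l (d / 2)" "y \<in> ball l (d / 2)" for x y
    using that dist_triangle_half_r[of l x d y] by auto
  ultimately have "range f \<subseteq> \<Union>?P" "\<forall>V\<in>?P. \<forall>x\<in>V. \<forall>y\<in>V. dist x y \<le> d"
    using assms(2) by (simp_all only: image_subset_iff ball_simps) auto
  then show ?thesis
    unfolding small_cover_def by (intro exI[of _ ?P]) simp
qed

lemma compact_closure_if_small_covers:
  fixes W :: "'a::banach set"
  assumes "\<And>d. d > 0 \<Longrightarrow> small_cover d W"
  shows "compact (closure W)"
  unfolding compact_eq_totally_bounded
proof (intro conjI allI impI)
  show "complete (closure W)" by (simp add: complete_eq_closed)
next
  fix e :: real assume e: "e > 0"
  then obtain P where P: "finite P" "W \<subseteq> \<Union>P" "\<And>V x y. V \<in> P \<Longrightarrow> x \<in> V \<Longrightarrow> y \<in> V \<Longrightarrow> dist x y \<le> e / 2"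
    using assms[of "e / 2"] unfolding small_cover_def by auto
  define k where "k = (\<lambda>V. SOME x. x \<in> V) ` P"
  have fin: "finite k" using P by (simp add: k_def)
  have "W \<subseteq> (\<Union>x\<in>k. cball x (e / 2))"
  proof
    fix x assume "x \<in> W"
    then obtain V where V: "V \<in> P" "x \<in> V" using P by blast
    then have "(SOME x. x \<in> V) \<in> V" by (meson someI)
    then have "x \<in> cball (SOME x. x \<in> V) (e / 2)" using P(3)[OF V(1)] V by auto
    then show "x \<in> (\<Union>x\<in>k. cball x (e / 2))" using V by (auto simp: k_def)
  qed
  then have "closure W \<subseteq> (\<Union>x\<in>k. cball x (e / 2))"
    using fin by (intro closure_minimal closed_UN) auto
  also have "\<dots> \<subseteq> (\<Union>x\<in>k. ball x e)" using e by fastforce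
  finally show "\<exists>k. finite k \<and> closure W \<subseteq> (\<Union>x\<in>k. ball x e)" using fin by blast
qed

text \<open>Refining a cover of the domain by the preimages of a cover of the image controls both
  diameters at once.\<close>

lemma small_cover_jointly:
  assumes "small_cover d W" "small_cover e (f ` W)"
  obtains P where "finite P" "W = \<Union>P" "\<And>V x y. V \<in> P \<Longrightarrow> x \<in> V \<Longrightarrow> y \<in> V \<Longrightarrow> dist x y \<le> d"
    "\<And>V x y. V \<in> P \<Longrightarrow> x \<in> V \<Longrightarrow> y \<in> V \<Longrightarrow> dist (f x) (f y) \<le> e"
proof -
  obtain P where P: "finite P" "W \<subseteq> \<Union>P" "\<forall>V\<in>P. \<forall>x\<in>V. \<forall>y\<in>V. dist x y \<le> d"
    using assms(1) unfolding small_cover_def by blast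
  obtain Q where Q: "finite Q" "f ` W \<subseteq> \<Union>Q" "\<forall>V\<in>Q. \<forall>x\<in>V. \<forall>y\<in>V. dist x y \<le> e"
    using assms(2) unfolding small_cover_def by blast
  let ?R = "(\<lambda>(V, U). W \<inter> V \<inter> f -` U) ` (P \<times> Q)"
  show thesis
  proof (rule that[of ?R])
    show "finite ?R" using P Q by blast
    show "W = \<Union>?R" using P(2) Q(2) by fastforce
  qed (use P(3) Q(3) in auto)
qed


section \<open>Closed operators whose approximate kernel is nearly compact\<close>

locale closed_operator =
  fixes D :: "'a::complex_banach set" and A :: "'a \<Rightarrow> 'a"
  assumes dom_subspace: "complex_vector.subspace D"
    and op_add: "x \<in> D \<Longrightarrow> y \<in> D \<Longrightarrow> A (x + y) = A x + A y"
    and op_scale: "x \<in> D \<Longrightarrow> A (c *\<^sub>C x) = c *\<^sub>C A x"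
    and op_closed: "\<lbrakk>\<And>n. z n \<in> D; z \<longlonglongrightarrow> x; (\<lambda>n. A (z n)) \<longlonglongrightarrow> w\<rbrakk> \<Longrightarrow> x \<in> D \<and> A x = w"
begin

definition shifted :: "complex \<Rightarrow> 'a \<Rightarrow> 'a" where
  "shifted \<mu> x = \<mu> *\<^sub>C x - A x"

text \<open>Negating this for all \<open>\<epsilon>\<close>, \<open>\<theta>\<close> and \<open>M\<close> says that \<open>\<mu>\<close> is an essential approximate eigenvalue: there
  are approximate eigenvectors at distance almost \<open>1 / 2\<close> from any given compact set. The bound
  \<open>1 / 2\<close> matters because differences of vectors in a set of diameter \<open>d\<close> have norm at most \<open>d\<close>;
  catching them in balls of radius \<open>\<theta> d\<close> yields pieces of diameter \<open>2 \<theta> d < d\<close>.\<close>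

definition trapped :: "complex \<Rightarrow> real \<Rightarrow> real \<Rightarrow> 'a set \<Rightarrow> bool" where
  "trapped \<mu> \<epsilon> \<theta> M \<longleftrightarrow> 0 < \<epsilon> \<and> \<theta> < 1 / 2 \<and> compact M \<and>
     (\<forall>v\<in>D. norm v \<le> 1 \<longrightarrow> norm (shifted \<mu> v) \<le> \<epsilon> \<longrightarrow> (\<exists>m\<in>M. norm (v - m) \<le> \<theta>))"

lemma shifted_0 [simp]: "shifted \<mu> 0 = 0"
  using op_scale[of 0 0] complex_vector.subspace_0[OF dom_subspace] by (simp add: shifted_def)

lemma shifted_add: "x \<in> D \<Longrightarrow> y \<in> D \<Longrightarrow> shifted \<mu> (x + y) = shifted \<mu> x + shifted \<mu> y"
  by (simp add: shifted_def op_add scaleC_add_right)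

lemma shifted_scale: "x \<in> D \<Longrightarrow> shifted \<mu> (c *\<^sub>C x) = c *\<^sub>C shifted \<mu> x"
  by (simp add: shifted_def op_scale scaleC_scaleC scaleC.diff_right mult.commute)

lemma shifted_scaleR: "x \<in> D \<Longrightarrow> shifted \<mu> (c *\<^sub>R x) = c *\<^sub>R shifted \<mu> x"
  using shifted_scale[of x \<mu> "complex_of_real c"] by (simp add: scaleC_of_real)

lemma dom_diff: "x \<in> D \<Longrightarrow> y \<in> D \<Longrightarrow> x - y \<in> D"
  using complex_vector.subspace_diff[OF dom_subspace] .

lemma dom_scaleR: "x \<in> D \<Longrightarrow> c *\<^sub>R x \<in> D"
  using subspace_scaleR[OF dom_subspace] .

lemma shifted_diff: "x \<in> D \<Longrightarrow> y \<in> D \<Longrightarrow> shifted \<mu> (x - y) = shifted \<mu> x - shifted \<mu> y"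
  using shifted_add[of "x - y" y \<mu>] dom_diff[of x y] by (simp add: algebra_simps)

lemma shifted_change: "shifted \<nu> x = shifted \<mu> x + (\<nu> - \<mu>) *\<^sub>C x"
  by (simp add: shifted_def scaleC.diff_left)

lemma shifted_closed:
  assumes "\<And>n. z n \<in> D" "z \<longlonglongrightarrow> x" "(\<lambda>n. shifted \<mu> (z n)) \<longlonglongrightarrow> w"
  shows "x \<in> D \<and> shifted \<mu> x = w"
proof -
  have "(\<lambda>n. \<mu> *\<^sub>C z n - shifted \<mu> (z n)) \<longlonglongrightarrow> \<mu> *\<^sub>C x - w"
    by (intro tendsto_intros scaleC.tendsto assms)
  then have "(\<lambda>n. A (z n)) \<longlonglongrightarrow> \<mu> *\<^sub>C x - w" by (simp add: shifted_def)
  from op_closed[OF assms(1,2) this] show ?thesis by (simp add: shifted_def)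
qed

lemma subspace_range: "complex_vector.subspace (shifted \<mu> ` D)"
  unfolding complex_vector.subspace_def
proof (intro conjI ballI allI)
  show "0 \<in> shifted \<mu> ` D"
    using complex_vector.subspace_0[OF dom_subspace] by (force intro: rev_image_eqI)
next
  fix x y assume "x \<in> shifted \<mu> ` D" "y \<in> shifted \<mu> ` D"
  then obtain x' y' where "x' \<in> D" "y' \<in> D" "x = shifted \<mu> x'" "y = shifted \<mu> y'" by blast
  then show "x + y \<in> shifted \<mu> ` D"
    using complex_vector.subspace_add[OF dom_subspace]
    by (intro image_eqI[of _ _ "x' + y'"]) (auto simp: shifted_add)
next
  fix c x assume "x \<in> shifted \<mu> ` D"
  then obtain x' where "x' \<in> D" "x = shifted \<mu> x'" by blast
  then show "c *\<^sub>C x \<in> shifted \<mu> ` D"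
    using complex_vector.subspace_scale[OF dom_subspace]
    by (intro image_eqI[of _ _ "c *\<^sub>C x'"]) (auto simp: shifted_scale)
qed

lemma subspace_kernel: "complex_vector.subspace {x \<in> D. shifted \<mu> x = 0}"
  unfolding complex_vector.subspace_def
  using dom_subspace by (auto simp: shifted_add shifted_scale complex_vector.subspace_def)

lemma closed_kernel: "closed {x \<in> D. shifted \<mu> x = 0}"
  unfolding closed_sequential_limits
proof (intro allI impI, elim conjE)
  fix z l assume "\<forall>n::nat. z n \<in> {x \<in> D. shifted \<mu> x = 0}" "z \<longlonglongrightarrow> l"
  then show "l \<in> {x \<in> D. shifted \<mu> x = 0}"
    using shifted_closed[of z l \<mu> 0] by auto
qed

text \<open>The same \<open>\<theta>\<close> and \<open>M\<close> serve a whole disc around \<open>\<mu>\<close>. This uniformity is what makes properties of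
  the range stable in both directions, from \<open>\<mu>\<close> to its neighbours and back.\<close>

lemma trapped_nearby:
  assumes "trapped \<mu> \<epsilon> \<theta> M" "cmod (\<nu> - \<mu>) \<le> \<epsilon> / 2"
  shows "trapped \<nu> (\<epsilon> / 2) \<theta> M"
  unfolding trapped_def
proof (intro conjI ballI impI)
  fix v assume v: "v \<in> D" "norm v \<le> 1" "norm (shifted \<nu> v) \<le> \<epsilon> / 2"
  have "norm (shifted \<mu> v) \<le> norm (shifted \<nu> v) + norm ((\<mu> - \<nu>) *\<^sub>C v)"
    unfolding shifted_change[of \<mu> v \<nu>] by (rule norm_triangle_ineq)
  also have "norm ((\<mu> - \<nu>) *\<^sub>C v) \<le> \<epsilon> / 2 * 1"
    unfolding norm_scaleC using assms v by (intro mult_mono) (auto simp: norm_minus_commute trapped_def)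
  finally have "norm (shifted \<mu> v) \<le> \<epsilon>" using v by simp
  then show "\<exists>m\<in>M. norm (v - m) \<le> \<theta>" using assms v by (auto simp: trapped_def)
qed (use assms in \<open>auto simp: trapped_def\<close>)

text \<open>In a piece \<open>V\<close> of small diameter whose image has small diameter, \<open>x - u\<close> divided by \<open>\<Delta>\<close> is an
  approximate kernel vector for all \<open>x\<close> in \<open>V\<close> and a fixed \<open>u\<close> in \<open>V\<close>. So \<open>V\<close> is covered by the balls
  of radius \<open>\<theta> \<Delta>\<close> around \<open>u + \<Delta> m\<close> with \<open>m\<close> in \<open>M\<close>, hence by finitely many slightly larger ones.\<close>

lemma small_cover_contract:
  assumes trap: "trapped \<mu> \<epsilon> \<theta> M" and W: "W \<subseteq> D" and \<Delta>: "\<Delta> > 0"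
    and cov: "small_cover \<Delta> W" "small_cover (\<epsilon> * \<Delta>) (shifted \<mu> ` W)"
  shows "small_cover ((\<theta> + 1 / 2) * \<Delta>) W"
proof -
  obtain P where P: "finite P" "W = \<Union>P" "\<And>V x y. V \<in> P \<Longrightarrow> x \<in> V \<Longrightarrow> y \<in> V \<Longrightarrow> dist x y \<le> \<Delta>"
    "\<And>V x y. V \<in> P \<Longrightarrow> x \<in> V \<Longrightarrow> y \<in> V \<Longrightarrow> dist (shifted \<mu> x) (shifted \<mu> y) \<le> \<epsilon> * \<Delta>"
    using small_cover_jointly[OF cov] by metis
  define \<kappa> where "\<kappa> = (1 / 2 - \<theta>) / 2"
  have "\<kappa> > 0" "compact M" using trap by (auto simp: \<kappa>_def trapped_def)
  then obtain k where k: "finite k" "M \<subseteq> (\<Union>m\<in>k. ball m \<kappa>)"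
    unfolding compact_eq_totally_bounded by blast
  define u where "u V = (SOME x. x \<in> V)" for V :: "'a set"
  define piece where "piece = (\<lambda>(V, m). {x. norm (x - u V - \<Delta> *\<^sub>R m) \<le> (\<theta> + \<kappa>) * \<Delta>})"
  have "x \<in> \<Union>(piece ` (P \<times> k))" if x: "x \<in> W" for x
  proof -
    obtain V where V: "V \<in> P" "x \<in> V" using x P(2) by blast
    then have uV: "u V \<in> V" unfolding u_def by (meson someI)
    then have D: "x \<in> D" "u V \<in> D" using V P W by auto
    define v where "v = (1 / \<Delta>) *\<^sub>R (x - u V)"
    have v: "v \<in> D" unfolding v_def using D by (intro dom_scaleR dom_diff)
    have "norm (x - u V) \<le> \<Delta>" using P(3)[OF V uV] by (simp add: dist_norm)
    then have "norm v \<le> 1" using \<Delta> by (simp add: v_def)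
    moreover have "norm (shifted \<mu> x - shifted \<mu> (u V)) \<le> \<epsilon> * \<Delta>"
      using P(4)[OF V uV] by (simp add: dist_norm)
    then have "norm (shifted \<mu> v) \<le> \<epsilon>"
      using \<Delta> by (simp add: v_def shifted_scaleR shifted_diff dom_diff D pos_divide_le_eq)
    ultimately obtain m where m: "m \<in> M" "norm (v - m) \<le> \<theta>"
      using trap v unfolding trapped_def by blast
    then obtain m' where m': "m' \<in> k" "dist m' m < \<kappa>" using k by auto
    have "norm (v - m') \<le> \<theta> + \<kappa>"
      using norm_triangle_ineq[of "v - m" "m - m'"] m m' by (simp add: dist_norm norm_minus_commute)
    moreover have "x - u V - \<Delta> *\<^sub>R m' = \<Delta> *\<^sub>R (v - m')"
      using \<Delta> by (simp add: v_def scaleR_right_diff_distrib)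
    ultimately have "norm (x - u V - \<Delta> *\<^sub>R m') \<le> (\<theta> + \<kappa>) * \<Delta>"
      using \<Delta> by (simp add: mult.commute)
    then show ?thesis using V m' by (auto simp: piece_def)
  qed
  moreover have "dist x y \<le> (\<theta> + 1 / 2) * \<Delta>" if U: "U \<in> piece ` (P \<times> k)" "x \<in> U" "y \<in> U" for U x y
  proof -
    obtain V m where "U = piece (V, m)" using U(1) by auto
    then have "norm (x - (u V + \<Delta> *\<^sub>R m)) \<le> (\<theta> + \<kappa>) * \<Delta>"
      "norm (y - (u V + \<Delta> *\<^sub>R m)) \<le> (\<theta> + \<kappa>) * \<Delta>"
      using U(2,3) by (simp_all add: piece_def diff_diff_eq)
    then have "dist x y \<le> (\<theta> + \<kappa>) * \<Delta> + (\<theta> + \<kappa>) * \<Delta>"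
      using dist_triangle2[of x y "u V + \<Delta> *\<^sub>R m"] unfolding dist_norm by linarith
    also have "\<dots> = (\<theta> + 1 / 2) * \<Delta>" by (simp add: \<kappa>_def field_simps)
    finally show ?thesis .
  qed
  ultimately show ?thesis
    unfolding small_cover_def using P(1) k(1)
    by (intro exI[of _ "piece ` (P \<times> k)"]) auto
qed

text \<open>The contraction can be iterated until the diameter reaches the size \<open>d\<close> allowed by the image.
  The diameter of \<open>W\<close> itself does not enter the result.\<close>

lemma small_cover_from_image:
  assumes trap: "trapped \<mu> \<epsilon> \<theta> M" and W: "W \<subseteq> D" "bounded W"
    and d: "d > 0" "small_cover (\<epsilon> * d) (shifted \<mu> ` W)"
  shows "small_cover d W"
proof -
  obtain \<Delta> where \<Delta>: "small_cover \<Delta> W" using small_cover_if_bounded[OF W(2)] by blast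
  define q where "q = max (\<theta> + 1 / 2) 0"
  have q: "0 \<le> q" "q < 1" "\<theta> + 1 / 2 \<le> q" using trap by (auto simp: q_def trapped_def)
  have iter: "small_cover (max d (q ^ n * \<Delta>)) W" for n
  proof (induction n)
    case 0
    show ?case by (rule small_cover_mono[OF \<Delta>]) auto
  next
    case (Suc n)
    let ?E = "max d (q ^ n * \<Delta>)"
    have E: "?E > 0" using d by simp
    have "\<epsilon> > 0" using trap by (simp add: trapped_def)
    then have "small_cover (\<epsilon> * ?E) (shifted \<mu> ` W)"
      by (intro small_cover_mono[OF d(2)] mult_left_mono) auto
    from small_cover_contract[OF trap W(1) E Suc this]
    have "small_cover ((\<theta> + 1 / 2) * ?E) W" .
    moreover have "(\<theta> + 1 / 2) * ?E \<le> q * ?E" using q E by (intro mult_right_mono) auto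
    moreover have "q * ?E \<le> max d (q ^ Suc n * \<Delta>)"
    proof (cases "d \<le> q ^ n * \<Delta>")
      case True
      then have "q * ?E = q ^ Suc n * \<Delta>" by (simp add: max_def)
      then show ?thesis by linarith
    next
      case False
      then have "q * ?E = q * d" by (simp add: max_def)
      also have "\<dots> \<le> d" using q d by (simp add: mult_left_le_one_le)
      finally show ?thesis by simp
    qed
    ultimately show ?case by (auto intro: small_cover_mono)
  qed
  have "(\<lambda>n. q ^ n * \<Delta>) \<longlonglongrightarrow> 0 * \<Delta>" using q by (intro tendsto_mult LIMSEQ_realpow_zero) auto
  then have "eventually (\<lambda>n. q ^ n * \<Delta> < d) sequentially" using d by (intro order_tendstoD(2)) auto
  then obtain n where "q ^ n * \<Delta> < d" using eventually_happens by force
  then show ?thesis using iter[of n] by (simp add: max_def)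
qed

lemma convergent_subseq:
  assumes trap: "trapped \<mu> \<epsilon> \<theta> M" and z: "\<And>n. z n \<in> D" "bounded (range z)"
    and lim: "(\<lambda>n. shifted \<mu> (z n)) \<longlonglongrightarrow> w"
  obtains s :: "nat \<Rightarrow> nat" and l where "strict_mono s" "(z \<circ> s) \<longlonglongrightarrow> l" "l \<in> D" "shifted \<mu> l = w"
proof -
  have \<epsilon>: "\<epsilon> > 0" using trap by (simp add: trapped_def)
  have "compact (closure (range z))"
  proof (rule compact_closure_if_small_covers)
    fix d :: real assume "d > 0"
    have "small_cover (\<epsilon> * d) (shifted \<mu> ` range z)"
      using small_cover_if_convergent[OF lim, of "\<epsilon> * d"] \<epsilon> \<open>d > 0\<close> by (simp add: image_image)
    then show "small_cover d (range z)"
      using z \<open>d > 0\<close> by (auto intro!: small_cover_from_image[OF trap, of "range z" d])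
  qed
  moreover have "\<forall>n. z n \<in> closure (range z)" using closure_subset by fast
  ultimately obtain s l where s: "strict_mono (s :: nat \<Rightarrow> nat)" "(z \<circ> s) \<longlonglongrightarrow> l"
    unfolding compact_def by metis
  have "l \<in> D \<and> shifted \<mu> l = w"
  proof (rule shifted_closed)
    show "(\<lambda>n. shifted \<mu> ((z \<circ> s) n)) \<longlonglongrightarrow> w"
      using LIMSEQ_subseq_LIMSEQ[OF lim s(1)] by (simp add: o_def)
  qed (use s z in \<open>auto simp: o_def\<close>)
  then show thesis using that s by blast
qed

text \<open>An open mapping estimate. If it failed, vectors at distance \<open>1\<close> from the kernel and of norm at most
  \<open>2\<close> would have images tending to \<open>0\<close>; a limit point of them would lie in the kernel.\<close>

lemma bounded_preimages:
  assumes trap: "trapped \<mu> \<epsilon> \<theta> M"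
  obtains c where "c > 0" "\<And>z. z \<in> D \<Longrightarrow> \<exists>v\<in>D. shifted \<mu> v = shifted \<mu> z \<and> norm v \<le> c * norm (shifted \<mu> z)"
proof -
  let ?N = "{x \<in> D. shifted \<mu> x = 0}"
  have ne: "?N \<noteq> {}" using complex_vector.subspace_0[OF subspace_kernel] by blast
  have "\<exists>n::nat. \<forall>z\<in>D. \<exists>v\<in>D. shifted \<mu> v = shifted \<mu> z \<and> norm v \<le> real (Suc n) * norm (shifted \<mu> z)"
  proof (rule ccontr)
    assume "\<not> ?thesis"
    then have "\<forall>n. \<exists>z\<in>D. \<forall>v\<in>D. shifted \<mu> v = shifted \<mu> z \<longrightarrow> norm v > real (Suc n) * norm (shifted \<mu> z)"
      by (simp only: not_ex not_all) (meson not_le)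
    then obtain z where z: "\<And>n. z n \<in> D"
      "\<And>n v. v \<in> D \<Longrightarrow> shifted \<mu> v = shifted \<mu> (z n) \<Longrightarrow> norm v > real (Suc n) * norm (shifted \<mu> (z n))"
      by metis
    define d where "d n = infdist (z n) ?N" for n
    have d: "d n > 0" for n
    proof -
      have "z n \<notin> ?N"
        using z(2)[of 0 n] complex_vector.subspace_0[OF dom_subspace] by auto
      then show ?thesis
        unfolding d_def using closed_kernel ne in_closed_iff_infdist_zero infdist_nonneg
        by (metis (no_types, lifting) less_eq_real_def)
    qed
    have "\<exists>k. k \<in> ?N \<and> dist (z n) k < 2 * d n" for n
      using infdist_lessD[OF _ ne, of "z n" "2 * d n"] d[of n] unfolding d_def by auto
    then obtain k where "\<forall>n. k n \<in> ?N \<and> dist (z n) (k n) < 2 * d n"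
      using choice[of "\<lambda>n k. k \<in> ?N \<and> dist (z n) k < 2 * d n"] by blast
    then have k: "\<And>n. k n \<in> ?N" "\<And>n. dist (z n) (k n) < 2 * d n" by blast+
    define u where "u n = (1 / d n) *\<^sub>R (z n - k n)" for n
    have zk: "z n - k n \<in> D" "shifted \<mu> (z n - k n) = shifted \<mu> (z n)" for n
      using z(1)[of n] k(1)[of n] by (auto simp: dom_diff shifted_diff)
    have uD: "u n \<in> D" for n unfolding u_def by (intro dom_scaleR zk)
    have nu: "norm (u n) \<le> 2" for n
      using k(2)[of n] d[of n] by (simp add: u_def dist_norm pos_divide_le_eq)
    have "norm (shifted \<mu> (u n)) \<le> 2 * inverse (real (Suc n))" for n
    proof -
      have "real (Suc n) * norm (shifted \<mu> (z n)) < 2 * d n"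
        using z(2)[OF zk, of n] k(2)[of n] unfolding dist_norm by (rule less_trans)
      then show ?thesis
        using d[of n] unfolding u_def shifted_scaleR[OF zk(1)] zk(2) by (simp add: field_simps)
    qed
    then have "eventually (\<lambda>n. norm (shifted \<mu> (u n)) \<le> 2 * inverse (real (Suc n))) sequentially" by simp
    then have ulim: "(\<lambda>n. shifted \<mu> (u n)) \<longlonglongrightarrow> 0"
      by (rule Lim_null_comparison) (rule tendsto_mult_right_zero[OF LIMSEQ_inverse_real_of_nat])
    have ubd: "bounded (range u)" using nu by (auto simp: bounded_iff)
    obtain s l where s: "strict_mono (s :: nat \<Rightarrow> nat)" "(u \<circ> s) \<longlonglongrightarrow> l" "l \<in> D" "shifted \<mu> l = 0"
      by (rule convergent_subseq[OF trap uD ubd ulim])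
    have far: "1 \<le> norm (u n - l)" for n
    proof -
      have "k n + d n *\<^sub>R l \<in> ?N"
        by (intro complex_vector.subspace_add[OF subspace_kernel k(1)] subspace_scaleR[OF subspace_kernel])
          (simp add: s)
      then have "d n \<le> norm (z n - (k n + d n *\<^sub>R l))"
        using infdist_le[of "k n + d n *\<^sub>R l" ?N "z n"] by (simp add: d_def dist_norm)
      also have "z n - (k n + d n *\<^sub>R l) = d n *\<^sub>R (u n - l)"
        using d[of n] by (simp add: u_def scaleR_right_diff_distrib)
      finally show ?thesis using d[of n] by simp
    qed
    have "(\<lambda>n. norm ((u \<circ> s) n - l)) \<longlonglongrightarrow> 0" using s(2) by (intro tendsto_norm_zero LIM_zero)
    then have "eventually (\<lambda>n. norm ((u \<circ> s) n - l) < 1) sequentially" by (rule order_tendstoD) simp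
    then obtain n where "norm ((u \<circ> s) n - l) < 1" using eventually_happens by force
    then show False using far[of "s n"] by simp
  qed
  then obtain n where "\<And>z. z \<in> D \<Longrightarrow>
      \<exists>v\<in>D. shifted \<mu> v = shifted \<mu> z \<and> norm v \<le> real (Suc n) * norm (shifted \<mu> z)"
    by blast
  then show thesis by (intro that[of "real (Suc n)"]) auto
qed

lemma closed_range:
  assumes trap: "trapped \<mu> \<epsilon> \<theta> M"
  shows "closed (shifted \<mu> ` D)"
  unfolding closed_sequential_limits
proof (intro allI impI, elim conjE)
  fix w l assume "\<forall>n::nat. w n \<in> shifted \<mu> ` D" and lim: "w \<longlonglongrightarrow> l"
  obtain c where c: "c > 0"
    "\<And>z. z \<in> D \<Longrightarrow> \<exists>v\<in>D. shifted \<mu> v = shifted \<mu> z \<and> norm v \<le> c * norm (shifted \<mu> z)"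
    using bounded_preimages[OF trap] by metis
  have "\<forall>n. \<exists>v\<in>D. shifted \<mu> v = w n \<and> norm v \<le> c * norm (w n)"
  proof
    fix n
    have "w n \<in> shifted \<mu> ` D" using \<open>\<forall>n. w n \<in> shifted \<mu> ` D\<close> by blast
    then obtain z where "z \<in> D" "shifted \<mu> z = w n" by force
    then show "\<exists>v\<in>D. shifted \<mu> v = w n \<and> norm v \<le> c * norm (w n)" using c(2) by force
  qed
  then obtain v where v: "\<And>n. v n \<in> D" "\<And>n. shifted \<mu> (v n) = w n" "\<And>n. norm (v n) \<le> c * norm (w n)"
    by metis
  have "bounded (range w)" using lim by (simp add: convergent_imp_bounded)
  then obtain b where b: "\<And>n. norm (w n) \<le> b" by (auto simp: bounded_iff)
  have "norm (v n) \<le> c * b" for n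
    using v(3)[of n] mult_left_mono[OF b[of n], of c] c(1) by linarith
  then have bd: "bounded (range v)" by (auto simp: bounded_iff)
  have vlim: "(\<lambda>n. shifted \<mu> (v n)) \<longlonglongrightarrow> l" using lim v(2) by simp
  show "l \<in> shifted \<mu> ` D"
    by (rule convergent_subseq[OF trap v(1) bd vlim]) blast
qed

text \<open>The unit ball of the kernel is compact.\<close>

lemma finite_dim_kernel:
  assumes trap: "trapped \<mu> \<epsilon> \<theta> M"
  shows "finite_dim {x \<in> D. shifted \<mu> x = 0}" (is "finite_dim ?N")
proof -
  let ?U = "?N \<inter> cball 0 1"
  have \<epsilon>: "\<epsilon> > 0" using trap by (simp add: trapped_def)
  have "compact (closure ?U)"
  proof (rule compact_closure_if_small_covers)
    fix d :: real assume "d > 0"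
    have "small_cover (\<epsilon> * d) (shifted \<mu> ` ?U)"
      using \<epsilon> \<open>d > 0\<close> by (intro small_cover_if_compact[of "{0}"]) auto
    moreover have "bounded ?U" by (simp add: bounded_Int)
    ultimately show "small_cover d ?U"
      using \<open>d > 0\<close> by (intro small_cover_from_image[OF trap, of ?U d]) auto
  qed
  moreover have "closed ?U" using closed_kernel by (intro closed_Int) auto
  ultimately have comp: "seq_compact ?U" by (simp add: compact_eq_seq_compact_metric)
  have half: "(0::real) < 1 / 2" by simp
  obtain F where F: "finite F" "F \<subseteq> ?U" "?U \<subseteq> (\<Union>x\<in>F. ball x (1 / 2))"
    using seq_compact_imp_totally_bounded[OF comp, rule_format, OF half] by (elim exE conjE)
  have "?N = complex_vector.span F"
  proof (rule subspace_eq_if_half_close)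
    show "closed (complex_vector.span F)"
      using closed_span_Un_finite[OF F(1), of "{}"] by simp
    show "complex_vector.span F \<subseteq> ?N"
      using F(2) by (intro complex_vector.span_minimal subspace_kernel) auto
  next
    fix x assume "x \<in> ?N" "norm x \<le> 1"
    then obtain f where "f \<in> F" "dist f x < 1 / 2" using F(3) by auto
    then show "\<exists>w\<in>complex_vector.span F. norm (x - w) \<le> 1 / 2"
      by (intro bexI[of _ f]) (auto simp: dist_norm norm_minus_commute complex_vector.span_base)
  qed (rule subspace_kernel complex_vector.subspace_span)+
  then show ?thesis unfolding finite_dim_def using F(1) by metis
qed

end

text \<open>For closed subspaces this is finite codimension, but it is stable under small changes of the
  subspace without any bookkeeping of complements.\<close>

definition almost_full :: "'a::complex_banach set \<Rightarrow> bool" where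
  "almost_full R \<longleftrightarrow> (\<exists>G. finite G \<and> (\<forall>x. norm x \<le> 1 \<longrightarrow> (\<exists>w\<in>R. \<exists>g\<in>G. norm (x - w - g) \<le> 1 / 2)))"

lemma almost_full_refine:
  assumes R: "complex_vector.subspace R" and full: "almost_full R"
  shows "\<exists>G. finite G \<and> (\<forall>x. norm x \<le> 1 \<longrightarrow> (\<exists>w\<in>R. \<exists>g\<in>G. norm (x - w - g) \<le> (1 / 2) ^ n))"
proof (induction n)
  case 0
  show ?case
    using complex_vector.subspace_0[OF R] by (intro exI[of _ "{0}"]) (auto intro: bexI[of _ 0])
next
  case (Suc n)
  let ?s = "(1 / 2) ^ n :: real"
  obtain G where G: "finite G" "\<And>x. norm x \<le> 1 \<Longrightarrow> \<exists>w\<in>R. \<exists>g\<in>G. norm (x - w - g) \<le> ?s"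
    using Suc by blast
  obtain G' where G': "finite G'" "\<And>x. norm x \<le> 1 \<Longrightarrow> \<exists>w\<in>R. \<exists>g\<in>G'. norm (x - w - g) \<le> 1 / 2"
    using full unfolding almost_full_def by blast
  let ?H = "(\<lambda>(g, g'). g + ?s *\<^sub>R g') ` (G \<times> G')"
  have "\<exists>w\<in>R. \<exists>h\<in>?H. norm (x - w - h) \<le> (1 / 2) ^ Suc n" if x: "norm x \<le> 1" for x
  proof -
    obtain w g where wg: "w \<in> R" "g \<in> G" "norm (x - w - g) \<le> ?s" using G(2)[OF x] by blast
    let ?e = "(1 / ?s) *\<^sub>R (x - w - g)"
    have "norm ?e \<le> 1" using wg(3) by (simp only: norm_scaleR) (simp add: field_simps)
    then obtain w' g' where w'g': "w' \<in> R" "g' \<in> G'" "norm (?e - w' - g') \<le> 1 / 2"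
      using G'(2) by blast
    have "x - (w + ?s *\<^sub>R w') - (g + ?s *\<^sub>R g') = ?s *\<^sub>R (?e - w' - g')"
      by (simp add: scaleR_right_diff_distrib)
    then have "norm (x - (w + ?s *\<^sub>R w') - (g + ?s *\<^sub>R g')) \<le> (1 / 2) ^ Suc n"
      using w'g'(3) by simp
    moreover have "w + ?s *\<^sub>R w' \<in> R"
      using wg w'g' R by (intro complex_vector.subspace_add subspace_scaleR)
    moreover have "g + ?s *\<^sub>R g' \<in> ?H" using wg(2) w'g'(2) by force
    ultimately show ?thesis by blast
  qed
  then show ?case using G(1) G'(1) by (intro exI[of _ ?H]) blast
qed

lemma finite_codim_if_almost_full:
  fixes R :: "'a::complex_banach set"
  assumes R: "complex_vector.subspace R" "closed R" and full: "almost_full R"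
  shows "finite_codim R"
proof -
  obtain G where G: "finite G" "\<And>x. norm x \<le> 1 \<Longrightarrow> \<exists>w\<in>R. \<exists>g\<in>G. norm (x - w - g) \<le> 1 / 2"
    using full unfolding almost_full_def by blast
  have span: "complex_vector.span R = R" using R(1) by (simp only: complex_vector.span_eq_iff)
  have "UNIV = complex_vector.span (R \<union> G)"
  proof (rule subspace_eq_if_half_close)
    show "closed (complex_vector.span (R \<union> G))"
      by (rule closed_span_Un_finite[OF G(1)]) (simp add: R span)
  next
    fix x :: 'a assume "norm x \<le> 1"
    then obtain w g where "w \<in> R" "g \<in> G" "norm (x - w - g) \<le> 1 / 2" using G(2) by blast
    then show "\<exists>w\<in>complex_vector.span (R \<union> G). norm (x - w) \<le> 1 / 2"
      by (intro bexI[of _ "w + g"]) (auto simp: diff_diff_eq intro: complex_vector.span_add complex_vector.span_base)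
  qed (auto simp: complex_vector.subspace_UNIV)
  then show ?thesis
    unfolding finite_codim_def using G(1) complex_vector.span_Un[of R G] span
    by (intro exI[of _ G]) auto
qed

context closed_operator
begin

text \<open>Every \<open>x\<close> in the unit ball is approximated within \<open>1 / 8\<close> by \<open>shifted \<mu> z + g\<close> with \<open>g\<close> from a finite
  set. For fixed \<open>g\<close> the images \<open>shifted \<mu> z\<close> lie in a set of diameter less than \<open>3\<close>, so finitely many
  classes suffice to make the \<open>z\<close> in one class differ by at most \<open>3 / \<epsilon>\<close>, a bound that involves
  neither the finite set nor the norms of the \<open>z\<close>. Subtracting two elements of the same class
  eliminates \<open>g\<close>, and replacing \<open>\<mu>\<close> by \<open>\<nu>\<close> costs at most \<open>\<epsilon> / 12 * (3 / \<epsilon>) = 1 / 4\<close>. So one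
  representative \<open>x'\<close> per class is a finite set that works for \<open>\<nu>\<close>.\<close>

lemma almost_full_range_nearby:
  assumes trap: "trapped \<mu> \<epsilon> \<theta> M" and near: "cmod (\<nu> - \<mu>) \<le> \<epsilon> / 12"
    and full: "almost_full (shifted \<mu> ` D)"
  shows "almost_full (shifted \<nu> ` D)"
proof -
  have \<epsilon>: "\<epsilon> > 0" using trap by (simp add: trapped_def)
  obtain c where c: "c > 0"
    "\<And>z. z \<in> D \<Longrightarrow> \<exists>v\<in>D. shifted \<mu> v = shifted \<mu> z \<and> norm v \<le> c * norm (shifted \<mu> z)"
    using bounded_preimages[OF trap] by metis
  obtain G where G: "finite G"
    "\<And>x. norm x \<le> 1 \<Longrightarrow> \<exists>w\<in>shifted \<mu> ` D. \<exists>g\<in>G. norm (x - w - g) \<le> (1 / 2) ^ 3"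
    using almost_full_refine[OF subspace_range full, of 3] by blast
  have "\<exists>z g. z \<in> D \<and> g \<in> G \<and> norm (x - shifted \<mu> z - g) \<le> 1 / 8 \<and> norm z \<le> c * norm (shifted \<mu> z)"
    if x: "norm x \<le> 1" for x
  proof -
    obtain z g where "z \<in> D" "g \<in> G" "norm (x - shifted \<mu> z - g) \<le> 1 / 8"
      using G(2)[OF x] by (force simp: power_divide)
    moreover obtain v where "v \<in> D" "shifted \<mu> v = shifted \<mu> z" "norm v \<le> c * norm (shifted \<mu> z)"
      using c(2)[OF \<open>z \<in> D\<close>] by blast
    ultimately show ?thesis by metis
  qed
  then obtain z g where zg: "\<And>x. norm x \<le> 1 \<Longrightarrow> z x \<in> D" "\<And>x. norm x \<le> 1 \<Longrightarrow> g x \<in> G"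
    "\<And>x. norm x \<le> 1 \<Longrightarrow> norm (x - shifted \<mu> (z x) - g x) \<le> 1 / 8"
    "\<And>x. norm x \<le> 1 \<Longrightarrow> norm (z x) \<le> c * norm (shifted \<mu> (z x))"
    by metis
  define W where "W = z ` cball 0 1"
  have WD: "W \<subseteq> D" using zg(1) by (auto simp: W_def)
  have near_g: "norm (shifted \<mu> (z x) + g x) \<le> 9 / 8" if "norm x \<le> 1" for x
  proof -
    have "norm (shifted \<mu> (z x) + g x) \<le> norm x + norm (x - shifted \<mu> (z x) - g x)"
      using norm_triangle_ineq4[of x "x - shifted \<mu> (z x) - g x"] by (simp add: algebra_simps)
    then show ?thesis using that zg(3)[OF that] by simp
  qed
  obtain b where b: "\<And>g. g \<in> G \<Longrightarrow> norm g \<le> b"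
    using finite_imp_bounded[OF G(1)] by (auto simp: bounded_iff)
  have "norm (z x) \<le> c * (9 / 8 + b)" if x: "norm x \<le> 1" for x
  proof -
    have "norm (shifted \<mu> (z x)) \<le> 9 / 8 + b"
      using norm_triangle_ineq4[of "shifted \<mu> (z x) + g x" "g x"] near_g[OF x] b[OF zg(2)[OF x]]
      by simp
    then show ?thesis using zg(4)[OF x] mult_left_mono[of _ "9 / 8 + b" c] c(1) by (meson less_imp_le order_trans)
  qed
  then have "bounded W" unfolding W_def bounded_iff by (intro exI[of _ "c * (9 / 8 + b)"]) auto
  moreover have "small_cover (\<epsilon> * (3 / \<epsilon>)) (shifted \<mu> ` W)"
    unfolding small_cover_def
  proof (intro exI conjI)
    show "finite ((\<lambda>g. cball (- g) (9 / 8)) ` G)" using G(1) by simp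
    show "shifted \<mu> ` W \<subseteq> \<Union>((\<lambda>g. cball (- g) (9 / 8)) ` G)"
    proof
      fix w assume "w \<in> shifted \<mu> ` W"
      then obtain x where "norm x \<le> 1" "w = shifted \<mu> (z x)" by (auto simp: W_def)
      then show "w \<in> \<Union>((\<lambda>g. cball (- g) (9 / 8)) ` G)"
        using near_g[of x] zg(2)[of x] norm_minus_cancel[of "g x + shifted \<mu> (z x)"]
        by (intro UN_I[of "g x"]) (simp_all add: dist_norm add.commute)
    qed
    have "dist x y \<le> \<epsilon> * (3 / \<epsilon>)" if "x \<in> cball h (9 / 8)" "y \<in> cball h (9 / 8)" for x y h :: 'a
      using that dist_triangle3[of x y h] \<epsilon> by simp
    then show "\<forall>V\<in>(\<lambda>g. cball (- g) (9 / 8)) ` G. \<forall>x\<in>V. \<forall>y\<in>V. dist x y \<le> \<epsilon> * (3 / \<epsilon>)" by blast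
  qed
  ultimately have "small_cover (3 / \<epsilon>) W"
    using \<epsilon> by (intro small_cover_from_image[OF trap WD, of "3 / \<epsilon>"]) auto
  then obtain P where P: "finite P" "W \<subseteq> \<Union>P" "\<And>V x y. V \<in> P \<Longrightarrow> x \<in> V \<Longrightarrow> y \<in> V \<Longrightarrow> dist x y \<le> 3 / \<epsilon>"
    unfolding small_cover_def by metis
  define rep where "rep = (\<lambda>(h, V). SOME x. norm x \<le> 1 \<and> g x = h \<and> z x \<in> V)"
  show ?thesis unfolding almost_full_def
  proof (intro exI[of _ "rep ` (G \<times> P)"] conjI allI impI)
    show "finite (rep ` (G \<times> P))" using G(1) P(1) by simp
  next
    fix x :: 'a assume x: "norm x \<le> 1"
    then obtain V where V: "V \<in> P" "z x \<in> V" using P(2) by (force simp: W_def)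
    define x' where "x' = rep (g x, V)"
    have x': "norm x' \<le> 1" "g x' = g x" "z x' \<in> V"
      using someI[of "\<lambda>x'. norm x' \<le> 1 \<and> g x' = g x \<and> z x' \<in> V" x] x V
      unfolding x'_def rep_def by auto
    let ?d = "z x - z x'"
    have dD: "?d \<in> D" using zg(1) x x' by (intro dom_diff) auto
    have "shifted \<nu> ?d = shifted \<mu> (z x) - shifted \<mu> (z x') + (\<nu> - \<mu>) *\<^sub>C ?d"
      using zg(1) x x' by (simp add: shifted_change[of \<nu> _ \<mu>] shifted_diff)
    then have "x - shifted \<nu> ?d - x' = (x - shifted \<mu> (z x) - g x) - (x' - shifted \<mu> (z x') - g x')
        - (\<nu> - \<mu>) *\<^sub>C ?d"
      using x'(2) by (simp add: algebra_simps)
    also have "norm \<dots> \<le> 1 / 8 + 1 / 8 + norm ((\<nu> - \<mu>) *\<^sub>C ?d)"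
      using zg(3)[OF x] zg(3)[OF x'(1)]
        norm_triangle_ineq4[of "x - shifted \<mu> (z x) - g x" "x' - shifted \<mu> (z x') - g x'"]
      by (intro norm_triangle_le_diff add_right_mono) linarith
    also have "norm ((\<nu> - \<mu>) *\<^sub>C ?d) \<le> \<epsilon> / 12 * (3 / \<epsilon>)"
      unfolding norm_scaleC using near P(3)[OF V x'(3)] \<epsilon> by (intro mult_mono) (auto simp: dist_norm)
    finally have "norm (x - shifted \<nu> ?d - x') \<le> 1 / 2" using \<epsilon> by simp
    moreover have "x' \<in> rep ` (G \<times> P)" using zg(2)[OF x] V by (auto simp: x'_def)
    ultimately show "\<exists>w\<in>shifted \<nu> ` D. \<exists>h\<in>rep ` (G \<times> P). norm (x - w - h) \<le> 1 / 2"
      using dD by blast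
  qed
qed

text \<open>On the connected set of points between \<open>\<mu>\<close> and \<open>\<mu> + S\<close> the property is locally constant.\<close>

lemma almost_full_range_along_ray:
  assumes trap: "\<And>s. 0 \<le> s \<Longrightarrow> \<exists>\<epsilon> \<theta> M. trapped (\<mu> + complex_of_real s) \<epsilon> \<theta> M"
    and S: "S \<ge> 0" and full: "almost_full (shifted (\<mu> + complex_of_real S) ` D)"
  shows "almost_full (shifted \<mu> ` D)"
proof -
  let ?Q = "\<lambda>s. almost_full (shifted (\<mu> + complex_of_real s) ` D)"
  have "?Q 0"
  proof (rule connected_induction_simple[of "{0..S}" S 0 ?Q])
    fix s assume "s \<in> {0..S}"
    then obtain \<epsilon> \<theta> M where t: "trapped (\<mu> + complex_of_real s) \<epsilon> \<theta> M" using trap[of s] by auto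
    then have \<epsilon>: "\<epsilon> > 0" by (simp add: trapped_def)
    \<comment> \<open>two points of the ball are less than \<open>\<epsilon> / 24\<close> apart, and near \<open>s\<close> the trapping constant is \<open>\<epsilon> / 2\<close>\<close>
    let ?T = "{0..S} \<inter> ball s (\<epsilon> / 48)"
    have "?Q y" if "x \<in> ?T" "y \<in> ?T" "?Q x" for x y
    proof (rule almost_full_range_nearby[OF _ _ that(3)])
      have "\<bar>x - s\<bar> \<le> \<epsilon> / 48" using that(1) by (simp add: dist_real_def abs_minus_commute)
      then show "trapped (\<mu> + complex_of_real x) (\<epsilon> / 2) \<theta> M"
        using \<epsilon> by (intro trapped_nearby[OF t]) (simp flip: of_real_diff)
      have "\<bar>y - x\<bar> \<le> \<epsilon> / 24" using that(1,2) unfolding Int_iff mem_ball dist_real_def by linarith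
      then show "cmod (\<mu> + complex_of_real y - (\<mu> + complex_of_real x)) \<le> \<epsilon> / 2 / 12"
        by (simp flip: of_real_diff)
    qed
    moreover have "openin (top_of_set {0..S}) ?T" by (simp add: openin_open_Int)
    moreover have "s \<in> ?T" using \<open>s \<in> {0..S}\<close> \<epsilon> by simp
    ultimately show "\<exists>T. openin (top_of_set {0..S}) T \<and> s \<in> T \<and> (\<forall>x\<in>T. \<forall>y\<in>T. ?Q x \<longrightarrow> ?Q y)"
      by blast
  qed (use S full in auto)
  then show ?thesis by simp
qed

text \<open>This replaces the usual argument that the Fredholm index is constant on connected sets of
  semi-Fredholm points.\<close>

lemma untrapped_right_of_essential_spectrum:
  assumes \<mu>: "\<mu> \<in> essential_spectrum D A"
    and S: "S \<ge> 0" "shifted (\<mu> + complex_of_real S) ` D = UNIV"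
  shows "\<exists>s\<ge>0. \<nexists>\<epsilon> \<theta> M. trapped (\<mu> + complex_of_real s) \<epsilon> \<theta> M"
proof (rule ccontr)
  assume "\<not> ?thesis"
  then have trap: "\<exists>\<epsilon> \<theta> M. trapped (\<mu> + complex_of_real s) \<epsilon> \<theta> M" if "s \<ge> 0" for s
    using that by blast
  have "almost_full (UNIV :: 'a set)" unfolding almost_full_def
  proof (intro exI[of _ "{0}"] conjI allI impI)
    show "\<exists>w\<in>UNIV. \<exists>g\<in>{0}. norm (x - w - g) \<le> 1 / 2" for x :: 'a
      by (rule bexI[of _ x]) auto
  qed simp
  then have full: "almost_full (shifted \<mu> ` D)"
    using almost_full_range_along_ray[OF trap S(1)] S(2) by simp
  obtain \<epsilon> \<theta> M where t: "trapped \<mu> \<epsilon> \<theta> M" using trap[of 0] by auto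
  have "fredholm D (shifted \<mu>)"
    unfolding fredholm_def
    using finite_dim_kernel[OF t] closed_range[OF t]
      finite_codim_if_almost_full[OF subspace_range closed_range[OF t] full] by blast
  then show False using \<mu> by (simp add: essential_spectrum_def shifted_def[abs_def])
qed

end


section \<open>Locally bounded strongly continuous semigroups\<close>

text \<open>A mean value inequality that needs only the derivative \<open>w\<close> at time \<open>0\<close>: the increment over \<open>[0, t]\<close>
  is the sum of the images under \<open>S (i t / n)\<close> of the increment over \<open>[0, t / n]\<close>, which is \<open>(t / n) w\<close>
  up to an error of smaller order.\<close>

lemma increment_estimate:
  fixes S :: "real \<Rightarrow> 'a::real_normed_vector \<Rightarrow> 'a"
  assumes lin: "\<And>s. 0 \<le> s \<Longrightarrow> linear (S s)" and S0: "S 0 z = z"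
    and add: "\<And>s t x. 0 \<le> s \<Longrightarrow> 0 \<le> t \<Longrightarrow> S (s + t) x = S s (S t x)"
    and bd: "\<And>s x. 0 \<le> s \<Longrightarrow> s \<le> t \<Longrightarrow> norm (S s x) \<le> C * norm x"
    and der: "((\<lambda>h. (1 / h) *\<^sub>R (S h z - z)) \<longlongrightarrow> w) (at_right 0)"
    and t: "t > 0" and v: "\<And>s. 0 \<le> s \<Longrightarrow> s \<le> t \<Longrightarrow> norm (S s w - v) \<le> b"
  shows "norm (S t z - z - t *\<^sub>R v) \<le> t * b"
proof -
  define h where "h n = t / real (Suc n)" for n
  have h: "h n > 0" for n using t by (simp add: h_def)
  define e where "e n = norm ((1 / h n) *\<^sub>R (S (h n) z - z) - w)" for n
  have "h \<longlonglongrightarrow> 0"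
    using tendsto_mult_right_zero[OF LIMSEQ_inverse_real_of_nat, of t] by (simp add: h_def[abs_def] divide_inverse)
  then have "filterlim h (at_right 0) sequentially"
    using h by (auto simp: filterlim_at less_imp_neq[THEN not_sym])
  then have "(\<lambda>n. (1 / h n) *\<^sub>R (S (h n) z - z)) \<longlonglongrightarrow> w"
    by (rule filterlim_compose[OF der])
  then have e0: "e \<longlonglongrightarrow> 0"
    unfolding e_def by (intro tendsto_norm_zero LIM_zero)
  \<comment> \<open>the division points are the multiples of \<open>h n = t / (n + 1)\<close>, and \<open>e n\<close> is the error of the difference quotient\<close>
  have step: "norm (S t z - z - t *\<^sub>R v) \<le> t * (C * e n + b)" for n
  proof -
    have tel: "S (real k * h n) z - z = (\<Sum>i<k. S (real i * h n) (S (h n) z - z))" for k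
    proof (induction k)
      case (Suc k)
      have nn: "0 \<le> real k * h n" using h[of n] by simp
      have "S (real (Suc k) * h n) z = S (real k * h n) (S (h n) z)"
        using add[OF nn, of "h n" z] h[of n] by (simp add: algebra_simps)
      then show ?case
        using linear_diff[OF lin[OF nn], of "S (h n) z" z] by (simp add: Suc[symmetric])
    qed (simp add: S0)
    have "S t z - z - t *\<^sub>R v = (\<Sum>i<Suc n. S (real i * h n) (S (h n) z - z) - h n *\<^sub>R v)"
      using tel[of "Suc n"] by (simp only: sum_subtractf sum_constant_scaleR) (simp add: h_def)
    also have "norm \<dots> \<le> (\<Sum>i<Suc n. h n * (C * e n + b))"
    proof (rule sum_norm_le)
      fix i assume i: "i \<in> {..<Suc n}"
      define s where "s = real i * h n"
      have "real i * t \<le> real (Suc n) * t" using i t by (intro mult_right_mono) auto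
      then have s: "0 \<le> s" "s \<le> t"
        using h[of n] t by (simp_all add: s_def h_def pos_divide_le_eq mult.commute)
      define q where "q = (1 / h n) *\<^sub>R (S (h n) z - z) - w"
      have "S s q = (1 / h n) *\<^sub>R S s (S (h n) z - z) - S s w"
        unfolding q_def using linear_diff[OF lin[OF s(1)]] linear_scale[OF lin[OF s(1)]] by metis
      then have "S s (S (h n) z - z) - h n *\<^sub>R v = h n *\<^sub>R (S s q + (S s w - v))"
        using h[of n] by (simp add: algebra_simps)
      moreover have "norm (S s q + (S s w - v)) \<le> C * e n + b"
        using bd[OF s, of q] v[OF s] norm_triangle_ineq[of "S s q" "S s w - v"]
        by (simp add: e_def q_def)
      ultimately show "norm (S (real i * h n) (S (h n) z - z) - h n *\<^sub>R v) \<le> h n * (C * e n + b)"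
        using h[of n] by (simp add: s_def[symmetric] mult_left_mono)
    qed
    also have "\<dots> = t * (C * e n + b)" by (simp add: h_def)
    finally show ?thesis .
  qed
  have "(\<lambda>n. t * (C * e n + b)) \<longlonglongrightarrow> t * (C * 0 + b)"
    by (intro tendsto_intros e0)
  then show ?thesis
    using step by (intro LIMSEQ_le_const[where X = "\<lambda>n. t * (C * e n + b)"]) auto
qed

lemma exp_quotient: "((\<lambda>h. complex_of_real (1 / h) * (exp (c * complex_of_real h) - 1)) \<longlongrightarrow> c) (at_right 0)"
proof -
  have "((\<lambda>z. exp (c * z)) has_field_derivative c) (at 0)"
    by (auto intro!: derivative_eq_intros)
  then have "((\<lambda>z. (exp (c * z) - 1) / z) \<longlongrightarrow> c) (at 0)"
    by (simp add: has_field_derivative_iff)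
  moreover have "filterlim complex_of_real (at 0) (at_right 0)"
    unfolding filterlim_at by (auto intro!: tendsto_eq_intros simp: eventually_at_filter)
  ultimately have "((\<lambda>h. (exp (c * complex_of_real h) - 1) / complex_of_real h) \<longlongrightarrow> c) (at_right 0)"
    by (rule filterlim_compose)
  then show ?thesis by (simp add: field_simps)
qed

locale locally_bounded_semigroup =
  fixes D :: "'a::complex_banach set" and A :: "'a \<Rightarrow> 'a" and T :: "real \<Rightarrow> 'a \<Rightarrow>\<^sub>L 'a"
  assumes gen: "generates D A T"
    and bounded_near_0: "\<exists>\<delta>>0. \<exists>C. \<forall>t\<in>{0..\<delta>}. norm (T t) \<le> C"
begin

lemma T_scale: "t \<ge> 0 \<Longrightarrow> T t (c *\<^sub>C x) = c *\<^sub>C T t x"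
  and T_0: "T 0 x = x"
  and T_add: "s \<ge> 0 \<Longrightarrow> t \<ge> 0 \<Longrightarrow> T (s + t) x = T s (T t x)"
  and T_tendsto: "((\<lambda>t. T t x) \<longlongrightarrow> x) (at_right 0)"
  using gen by (auto simp: generates_def C0_semigroup_def)

lemma dom_eq: "D = {x. \<exists>z. ((\<lambda>h. (1 / h) *\<^sub>R (T h x - x)) \<longlongrightarrow> z) (at_right 0)}"
  and op_tendsto: "x \<in> D \<Longrightarrow> ((\<lambda>h. (1 / h) *\<^sub>R (T h x - x)) \<longlongrightarrow> A x) (at_right 0)"
  using gen by (auto simp: generates_def)

lemma op_eqI:
  assumes "((\<lambda>h. (1 / h) *\<^sub>R (T h x - x)) \<longlongrightarrow> w) (at_right 0)"
  shows "x \<in> D" "A x = w"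
proof -
  show "x \<in> D" using assms dom_eq by blast
  then show "A x = w"
    using tendsto_unique[OF _ op_tendsto assms] by simp
qed

text \<open>By the semigroup law, every further time span \<open>\<delta>\<close> multiplies the bound by at most the same constant.\<close>

lemma bounded_on_compact:
  obtains C where "C \<ge> 1" "\<And>t. 0 \<le> t \<Longrightarrow> t \<le> \<tau> \<Longrightarrow> norm (T t) \<le> C"
proof -
  obtain \<delta> C where \<delta>: "\<delta> > 0" "\<And>t. 0 \<le> t \<Longrightarrow> t \<le> \<delta> \<Longrightarrow> norm (T t) \<le> C"
    using bounded_near_0 by (metis atLeastAtMost_iff)
  define E where "E = max C 1"
  have E: "E \<ge> 1" "\<And>t. 0 \<le> t \<Longrightarrow> t \<le> \<delta> \<Longrightarrow> norm (T t) \<le> E"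
    using \<delta>(2) by (force simp: E_def max_def)+
  have pow: "norm (T t) \<le> E ^ Suc n" if "0 \<le> t" "t \<le> real (Suc n) * \<delta>" for n t
    using that
  proof (induction n arbitrary: t)
    case 0
    then show ?case using E(2) by simp
  next
    case (Suc n)
    show ?case
    proof (cases "t \<le> \<delta>")
      case True
      then have "norm (T t) \<le> E" using Suc.prems E(2) by simp
      also have "E \<le> E ^ Suc (Suc n)" using E(1) self_le_power by blast
      finally show ?thesis .
    next
      case False
      then have "T t = T \<delta> o\<^sub>L T (t - \<delta>)"
        using T_add[of \<delta> "t - \<delta>"] \<delta>(1) by (intro blinfun_eqI) simp
      then have "norm (T t) \<le> norm (T \<delta>) * norm (T (t - \<delta>))"
        by (simp add: norm_blinfun_compose)
      also have "\<dots> \<le> E * E ^ Suc n"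
        using False Suc E \<delta>(1) by (intro mult_mono) (auto simp: algebra_simps)
      finally show ?thesis by simp
    qed
  qed
  obtain n :: nat where "\<tau> / \<delta> \<le> real n" using real_arch_simple by blast
  then have "\<tau> \<le> real (Suc n) * \<delta>" using \<delta>(1) by (simp add: field_simps)
  then have "norm (T t) \<le> E ^ Suc n" if "0 \<le> t" "t \<le> \<tau>" for t
    using pow[of t n] that by linarith
  then show thesis using that one_le_power[OF E(1)] by blast
qed

text \<open>Strong continuity at time \<open>0\<close> controls the flow jointly in time and space, uniformly on bounded
  time intervals.\<close>

lemma orbit_modulus:
  assumes "\<And>t. 0 \<le> t \<Longrightarrow> t \<le> \<tau> \<Longrightarrow> norm (T t) \<le> C" "0 \<le> s" "s \<le> \<tau>" "0 \<le> t" "t \<le> \<tau>"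
  shows "norm (T s x - T t x') \<le> C * norm (T \<bar>s - t\<bar> x' - x') + C * norm (x - x')"
proof -
  have key: "norm (T t x' - T s x') \<le> C * norm (T (t - s) x' - x')"
    if "0 \<le> s" "s \<le> t" "t \<le> \<tau>" for s t
  proof -
    have "T t x' - T s x' = T s (T (t - s) x' - x')"
      using T_add[of s "t - s" x'] that by (simp add: blinfun.diff_right)
    then have "norm (T t x' - T s x') \<le> norm (T s) * norm (T (t - s) x' - x')"
      by (simp add: norm_blinfun)
    also have "\<dots> \<le> C * norm (T (t - s) x' - x')"
      using assms(1)[of s] that by (intro mult_right_mono) auto
    finally show ?thesis .
  qed
  have "norm (T s x' - T t x') \<le> C * norm (T \<bar>s - t\<bar> x' - x')"
    using key[of s t] key[of t s] assms by (cases "s \<le> t") (auto simp: norm_minus_commute)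
  moreover have "norm (T s x - T s x') \<le> C * norm (x - x')"
    unfolding blinfun.diff_right[symmetric]
    using norm_blinfun[of "T s" "x - x'"] assms(1)[of s] assms(2,3)
    by (meson mult_right_mono norm_ge_zero order_trans)
  ultimately show ?thesis
    using norm_triangle_ineq[of "T s x - T s x'" "T s x' - T t x'"] by simp
qed

lemma orbit_small_times:
  assumes "e > 0"
  obtains \<delta> where "\<delta> > 0" "\<And>t. 0 \<le> t \<Longrightarrow> t \<le> \<delta> \<Longrightarrow> norm (T t x - x) \<le> e"
proof -
  have "eventually (\<lambda>t. dist (T t x) x < e) (at_right 0)"
    using T_tendsto assms by (rule tendstoD)
  then obtain b where b: "b > 0" "\<And>t. 0 < t \<Longrightarrow> t < b \<Longrightarrow> dist (T t x) x < e"
    unfolding eventually_at_right_field by auto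
  have "norm (T t x - x) \<le> e" if "0 \<le> t" "t \<le> b / 2" for t
    using b(2)[of t] b(1) that assms by (cases "t = 0") (auto simp: T_0 dist_norm)
  then show thesis using that[of "b / 2"] b(1) by simp
qed

lemma continuous_on_flow: "continuous_on ({0..} \<times> UNIV) (\<lambda>(t, x). T t x)"
  unfolding continuous_on_iff
proof (intro ballI allI impI)
  fix p e assume p: "p \<in> {0::real..} \<times> (UNIV :: 'a set)" and e: "(e::real) > 0"
  obtain t x where tx: "p = (t, x)" "t \<ge> 0" using p by auto
  obtain C where C: "C \<ge> 1" "\<And>s. 0 \<le> s \<Longrightarrow> s \<le> t + 1 \<Longrightarrow> norm (T s) \<le> C"
    using bounded_on_compact[of "t + 1"] by metis
  define e' where "e' = e / (4 * C)"
  have e': "e' > 0" using e C by (simp add: e'_def)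
  obtain \<delta> where \<delta>: "\<delta> > 0" "\<And>t. 0 \<le> t \<Longrightarrow> t \<le> \<delta> \<Longrightarrow> norm (T t x - x) \<le> e'"
    using orbit_small_times[OF e', of x] by metis
  define d where "d = min (min \<delta> e') 1"
  have d: "d > 0" "d \<le> \<delta>" "d \<le> e'" "d \<le> 1" using \<delta> e' by (auto simp: d_def)
  have "dist (T s z) (T t x) < e" if "s \<ge> 0" "dist (s, z) (t, x) < d" for s z
  proof -
    have "\<bar>s - t\<bar> < d" "norm (z - x) < d"
      using that(2) dist_fst_le[of "(s, z)" "(t, x)"] dist_snd_le[of "(s, z)" "(t, x)"]
      by (auto simp: dist_norm)
    moreover from this have "norm (T s z - T t x) \<le> C * norm (T \<bar>s - t\<bar> x - x) + C * norm (z - x)"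
      using tx that(1) d(4) by (intro orbit_modulus[OF C(2)]) auto
    moreover have "C * norm (T \<bar>s - t\<bar> x - x) \<le> C * e'" "C * norm (z - x) \<le> C * e'"
      using calculation(1,2) d C(1) by (auto intro!: mult_left_mono \<delta>(2))
    ultimately have "norm (T s z - T t x) \<le> C * e' + C * e'" by linarith
    also have "\<dots> < e" using e C(1) by (simp add: e'_def)
    finally show ?thesis by (simp add: dist_norm)
  qed
  then show "\<exists>d>0. \<forall>q\<in>{0..} \<times> UNIV. dist q p < d \<longrightarrow>
      dist (case q of (t, x) \<Rightarrow> T t x) (case p of (t, x) \<Rightarrow> T t x) < e"
    using d(1) tx by (intro exI[of _ d]) auto
qed

lemma continuous_on_orbit [continuous_intros]:
  assumes "continuous_on S f" "continuous_on S g" "\<And>s. s \<in> S \<Longrightarrow> 0 \<le> f s"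
  shows "continuous_on S (\<lambda>s. T (f s) (g s))"
  using continuous_on_compose2[OF continuous_on_flow continuous_on_Pair[OF assms(1,2)]] assms(3)
  by auto

lemma difference_quotient_estimate:
  assumes z: "z \<in> D" and t: "t > 0" and v: "\<And>s. 0 \<le> s \<Longrightarrow> s \<le> t \<Longrightarrow> norm (T s (A z) - v) \<le> b"
  shows "norm ((1 / t) *\<^sub>R (T t z - z) - v) \<le> b"
proof -
  obtain C where C: "C \<ge> 1" "\<And>s. 0 \<le> s \<Longrightarrow> s \<le> t \<Longrightarrow> norm (T s) \<le> C"
    using bounded_on_compact[of t] by metis
  have "norm (T s x) \<le> C * norm x" if "0 \<le> s" "s \<le> t" for s x
    using norm_blinfun[of "T s" x] C(2)[OF that] by (meson mult_right_mono norm_ge_zero order_trans)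
  then have "norm (T t z - z - t *\<^sub>R v) \<le> t * b"
    using v t by (intro increment_estimate[of "\<lambda>s x. T s x", OF _ T_0 T_add _ op_tendsto[OF z]])
      (auto intro: bounded_linear.linear blinfun.bounded_linear_right)
  moreover have "(1 / t) *\<^sub>R (T t z - z) - v = (1 / t) *\<^sub>R (T t z - z - t *\<^sub>R v)"
    using t by (simp add: scaleR_right_diff_distrib)
  ultimately show ?thesis using t by (simp add: pos_divide_le_eq mult.commute)
qed

text \<open>A generator is closed since \<open>T h z - z\<close> is \<open>h A z\<close> up to \<open>h\<close> times the oscillation of \<open>T s (A z)\<close>
  over \<open>[0, h]\<close>, an estimate that survives the passage to the limit along \<open>z\<^sub>n\<close> and \<open>A z\<^sub>n\<close>.\<close>

sublocale closed_operator D A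
proof
  have add: "((\<lambda>h. (1 / h) *\<^sub>R (T h (x + y) - (x + y))) \<longlongrightarrow> A x + A y) (at_right 0)"
    if "x \<in> D" "y \<in> D" for x y
  proof -
    have "(1 / h) *\<^sub>R (T h (x + y) - (x + y)) = (1 / h) *\<^sub>R (T h x - x) + (1 / h) *\<^sub>R (T h y - y)" for h
      by (simp add: blinfun.add_right algebra_simps)
    then show ?thesis using tendsto_add[OF op_tendsto[OF that(1)] op_tendsto[OF that(2)]] by simp
  qed
  have scale: "((\<lambda>h. (1 / h) *\<^sub>R (T h (c *\<^sub>C x) - c *\<^sub>C x)) \<longlongrightarrow> c *\<^sub>C A x) (at_right 0)"
    if "x \<in> D" for x c
  proof -
    have "((\<lambda>h. c *\<^sub>C ((1 / h) *\<^sub>R (T h x - x))) \<longlongrightarrow> c *\<^sub>C A x) (at_right 0)"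
      by (intro scaleC.tendsto tendsto_const op_tendsto that)
    moreover have "eventually (\<lambda>h. c *\<^sub>C ((1 / h) *\<^sub>R (T h x - x)) =
        (1 / h) *\<^sub>R (T h (c *\<^sub>C x) - c *\<^sub>C x)) (at_right 0)"
      using eventually_at_right_less[of 0]
      by eventually_elim (simp add: T_scale scaleC.scaleR_right scaleC.diff_right)
    ultimately show ?thesis by (rule Lim_transform_eventually)
  qed
  show "x \<in> D \<Longrightarrow> y \<in> D \<Longrightarrow> A (x + y) = A x + A y" for x y using add op_eqI by blast
  show "x \<in> D \<Longrightarrow> A (c *\<^sub>C x) = c *\<^sub>C A x" for x c using scale op_eqI by blast
  show "complex_vector.subspace D"
    unfolding complex_vector.subspace_def
    using op_eqI(1)[of 0 0] op_eqI(1)[OF add] op_eqI(1)[OF scale] by (auto simp: blinfun.zero_right)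
next
  fix z x w assume z: "\<And>n::nat. z n \<in> D" and zx: "z \<longlonglongrightarrow> x" and Az: "(\<lambda>n. A (z n)) \<longlonglongrightarrow> w"
  have "((\<lambda>h. (1 / h) *\<^sub>R (T h x - x)) \<longlongrightarrow> w) (at_right 0)"
  proof (rule tendstoI)
    fix e :: real assume e: "e > 0"
    obtain \<delta> where \<delta>: "\<delta> > 0" "\<And>t. 0 \<le> t \<Longrightarrow> t \<le> \<delta> \<Longrightarrow> norm (T t w - w) \<le> e / 2"
      using orbit_small_times[of "e / 2" w] e by auto
    obtain C where C: "C \<ge> 1" "\<And>s. 0 \<le> s \<Longrightarrow> s \<le> \<delta> \<Longrightarrow> norm (T s) \<le> C"
      using bounded_on_compact[of \<delta>] by metis
    have "dist ((1 / h) *\<^sub>R (T h x - x)) w < e" if h: "0 < h" "h < \<delta>" for h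
    proof -
      have "norm ((1 / h) *\<^sub>R (T h (z n) - z n) - w) \<le> C * norm (A (z n) - w) + e / 2" for n
      proof (rule difference_quotient_estimate[OF z h(1)])
        fix s assume s: "0 \<le> s" "s \<le> h"
        have "norm (T s (A (z n)) - T s w) \<le> C * norm (A (z n) - w)"
          unfolding blinfun.diff_right[symmetric]
          using norm_blinfun[of "T s" "A (z n) - w"] C(2)[of s] s h
          by (meson less_imp_le mult_right_mono norm_ge_zero order_trans)
        moreover have "norm (T s w - w) \<le> e / 2" using \<delta>(2) s h by simp
        ultimately show "norm (T s (A (z n)) - w) \<le> C * norm (A (z n) - w) + e / 2"
          using norm_triangle_ineq[of "T s (A (z n)) - T s w" "T s w - w"] by simp
      qed
      moreover have "(\<lambda>n. norm ((1 / h) *\<^sub>R (T h (z n) - z n) - w))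
          \<longlonglongrightarrow> norm ((1 / h) *\<^sub>R (T h x - x) - w)"
        by (intro tendsto_intros zx blinfun.tendsto)
      moreover have "(\<lambda>n. C * norm (A (z n) - w) + e / 2) \<longlonglongrightarrow> C * 0 + e / 2"
        by (intro tendsto_intros tendsto_norm_zero LIM_zero Az)
      ultimately have "norm ((1 / h) *\<^sub>R (T h x - x) - w) \<le> C * 0 + e / 2"
        by (intro LIMSEQ_le) auto
      then show ?thesis using e by (simp add: dist_norm)
    qed
    then show "eventually (\<lambda>h. dist ((1 / h) *\<^sub>R (T h x - x)) w < e) (at_right 0)"
      unfolding eventually_at_right_field using \<delta>(1) by blast
  qed
  then show "x \<in> D \<and> A x = w" using op_eqI by blast
qed

text \<open>Multiplication by \<open>exp (-\<mu> t)\<close> yields the semigroup generated by \<open>A - \<mu>\<close>.\<close>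

definition rescaled :: "complex \<Rightarrow> real \<Rightarrow> 'a \<Rightarrow> 'a" where
  "rescaled \<mu> t x = exp (- \<mu> * complex_of_real t) *\<^sub>C T t x"

lemma linear_rescaled: "linear (rescaled \<mu> t)"
  by (rule linearI)
    (simp_all add: rescaled_def blinfun.add_right blinfun.scaleR_right scaleC_add_right scaleC.scaleR_right)

lemma rescaled_0: "rescaled \<mu> 0 x = x"
  by (simp add: rescaled_def T_0 scaleC_one)

lemma rescaled_add:
  "s \<ge> 0 \<Longrightarrow> t \<ge> 0 \<Longrightarrow> rescaled \<mu> (s + t) x = rescaled \<mu> s (rescaled \<mu> t x)"
  by (simp add: rescaled_def T_add T_scale scaleC_scaleC distrib_left flip: exp_add)

lemma norm_rescaled: "norm (rescaled \<mu> t x) = exp (- Re \<mu> * t) * norm (T t x)"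
  by (simp add: rescaled_def norm_scaleC norm_exp_eq_Re)

lemma continuous_on_rescaled: "continuous_on {0..} (\<lambda>t. rescaled \<mu> t x)"
  unfolding rescaled_def
  by (intro scaleC.continuous_on continuous_intros) auto

lemma rescaled_quotient:
  assumes "((\<lambda>h. (1 / h) *\<^sub>R (T h x - x)) \<longlongrightarrow> w) (at_right 0)"
  shows "((\<lambda>h. (1 / h) *\<^sub>R (rescaled \<mu> h x - x)) \<longlongrightarrow> w - \<mu> *\<^sub>C x) (at_right 0)"
proof -
  have eq: "(1 / h) *\<^sub>R (rescaled \<mu> h x - x) =
      (complex_of_real (1 / h) * (exp (- \<mu> * complex_of_real h) - 1)) *\<^sub>C T h x + (1 / h) *\<^sub>R (T h x - x)" for h
    by (simp only: scaleC_scaleC[symmetric] scaleC_of_real)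
      (simp add: rescaled_def scaleC.diff_left scaleC_one algebra_simps)
  have "((\<lambda>h. (complex_of_real (1 / h) * (exp (- \<mu> * complex_of_real h) - 1)) *\<^sub>C T h x
      + (1 / h) *\<^sub>R (T h x - x)) \<longlongrightarrow> (- \<mu>) *\<^sub>C x + w) (at_right 0)"
    by (intro tendsto_add scaleC.tendsto exp_quotient T_tendsto assms)
  then show ?thesis unfolding eq by (simp add: scaleC.minus_left)
qed

lemma unrescaled_quotient:
  assumes "((\<lambda>h. (1 / h) *\<^sub>R (rescaled \<mu> h x - x)) \<longlongrightarrow> w) (at_right 0)"
  shows "x \<in> D" "A x = w + \<mu> *\<^sub>C x"
proof -
  have resc: "T h x = exp (\<mu> * complex_of_real h) *\<^sub>C rescaled \<mu> h x" for h
    by (simp add: rescaled_def scaleC_scaleC scaleC_one flip: exp_add)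
  have eq: "(1 / h) *\<^sub>R (T h x - x) =
      (complex_of_real (1 / h) * (exp (\<mu> * complex_of_real h) - 1)) *\<^sub>C rescaled \<mu> h x
        + (1 / h) *\<^sub>R (rescaled \<mu> h x - x)" for h
    by (simp only: scaleC_scaleC[symmetric] scaleC_of_real)
      (simp add: resc scaleC.diff_left scaleC_one algebra_simps)
  have lim: "((\<lambda>h. rescaled \<mu> h x) \<longlongrightarrow> x) (at_right 0)"
    unfolding rescaled_def
    by (rule tendsto_eq_rhs[where x = "exp (- \<mu> * complex_of_real 0) *\<^sub>C x"])
      (intro tendsto_intros scaleC.tendsto T_tendsto, simp add: scaleC_one)
  have "((\<lambda>h. (complex_of_real (1 / h) * (exp (\<mu> * complex_of_real h) - 1)) *\<^sub>C rescaled \<mu> h x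
      + (1 / h) *\<^sub>R (rescaled \<mu> h x - x)) \<longlongrightarrow> \<mu> *\<^sub>C x + w) (at_right 0)"
    by (intro tendsto_add scaleC.tendsto exp_quotient lim assms)
  then have "((\<lambda>h. (1 / h) *\<^sub>R (T h x - x)) \<longlongrightarrow> w + \<mu> *\<^sub>C x) (at_right 0)"
    unfolding eq by (simp add: add.commute)
  then show "x \<in> D" "A x = w + \<mu> *\<^sub>C x" by (rule op_eqI)+
qed

text \<open>The increment estimate for the rescaled semigroup, in which \<open>z\<close> is almost stationary.\<close>

lemma approximate_eigenvector_orbit:
  assumes z: "z \<in> D" and C: "\<And>s. 0 \<le> s \<Longrightarrow> s \<le> \<tau> \<Longrightarrow> norm (T s) \<le> C"
    and t: "0 \<le> t" "t \<le> \<tau>"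
  shows "norm (T t z - exp (\<mu> * complex_of_real t) *\<^sub>C z)
    \<le> \<tau> * C * exp (2 * \<bar>Re \<mu>\<bar> * \<tau>) * norm (shifted \<mu> z)"
proof (cases "t = 0")
  case True
  have "0 \<le> C" using C[of t] t norm_ge_zero order_trans by blast
  then show ?thesis using True t by (simp add: T_0 scaleC_one)
next
  case False
  have C0: "0 \<le> C" using C[of t] t norm_ge_zero order_trans by blast
  let ?E = "exp (\<bar>Re \<mu>\<bar> * \<tau>)"
  have exp_le: "exp (- Re \<mu> * s) \<le> ?E" "exp (Re \<mu> * s) \<le> ?E" if "0 \<le> s" "s \<le> \<tau>" for s
  proof -
    have "\<bar>Re \<mu> * s\<bar> \<le> \<bar>Re \<mu>\<bar> * \<tau>" unfolding abs_mult using that by (intro mult_mono) auto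
    then show "exp (- Re \<mu> * s) \<le> ?E" "exp (Re \<mu> * s) \<le> ?E" by auto
  qed
  have bd: "norm (rescaled \<mu> s x) \<le> (?E * C) * norm x" if "0 \<le> s" "s \<le> t" for s x
  proof -
    have "norm (T s x) \<le> C * norm x"
      using norm_blinfun[of "T s" x] C[of s] that t by (meson mult_right_mono norm_ge_zero order_trans)
    then show ?thesis
      unfolding norm_rescaled mult.assoc using exp_le(1)[of s] that t C0
      by (intro mult_mono) auto
  qed
  have "norm (rescaled \<mu> t z - z - t *\<^sub>R 0) \<le> t * (?E * C * norm (A z - \<mu> *\<^sub>C z))"
    using bd False t
    by (intro increment_estimate[OF linear_rescaled rescaled_0 rescaled_add _ rescaled_quotient[OF op_tendsto[OF z]]])
      auto
  then have incr: "norm (rescaled \<mu> t z - z) \<le> t * (?E * C * norm (shifted \<mu> z))"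
    by (simp add: shifted_def norm_minus_commute)
  have "T t z - exp (\<mu> * complex_of_real t) *\<^sub>C z = exp (\<mu> * complex_of_real t) *\<^sub>C (rescaled \<mu> t z - z)"
    by (simp add: rescaled_def scaleC.diff_right scaleC_scaleC scaleC_one flip: exp_add)
  then have "norm (T t z - exp (\<mu> * complex_of_real t) *\<^sub>C z) = exp (Re \<mu> * t) * norm (rescaled \<mu> t z - z)"
    by (simp add: norm_scaleC norm_exp_eq_Re)
  also have "\<dots> \<le> ?E * (\<tau> * (?E * C * norm (shifted \<mu> z)))"
  proof (rule mult_mono)
    show "norm (rescaled \<mu> t z - z) \<le> \<tau> * (?E * C * norm (shifted \<mu> z))"
    proof (rule order_trans[OF incr], rule mult_right_mono[OF t(2)])
      show "0 \<le> ?E * C * norm (shifted \<mu> z)" using C0 by (intro mult_nonneg_nonneg) auto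
    qed
  qed (use exp_le t in auto)
  also have "\<dots> = \<tau> * C * (?E * ?E) * norm (shifted \<mu> z)" by (simp add: mult_ac)
  also have "?E * ?E = exp (2 * \<bar>Re \<mu>\<bar> * \<tau>)" by (simp flip: exp_add)
  finally show ?thesis .
qed

text \<open>The truncated Laplace integral \<open>R x\<close> of the rescaled semigroup satisfies
  \<open>(\<mu> - A) (R x) = x - S 1 x\<close> for \<open>S = rescaled \<mu>\<close>, and \<open>x - S 1 x = w\<close> is solvable by Banach's
  fixed point theorem once \<open>S 1\<close> is a contraction.\<close>

lemma truncated_laplace:
  fixes x :: 'a and \<mu> :: complex
  defines "v \<equiv> integral {0..1} (\<lambda>t. rescaled \<mu> t x)"
  shows "v \<in> D" "shifted \<mu> v = x - rescaled \<mu> 1 x"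
proof -
  let ?f = "\<lambda>t. rescaled \<mu> t x"
  have int: "?f integrable_on {a..b}" if "0 \<le> a" for a b
    using that by (intro integrable_continuous_real continuous_on_subset[OF continuous_on_rescaled]) auto
  have right: "((\<lambda>h. (1 / h) *\<^sub>R integral {a..a + h} ?f) \<longlongrightarrow> ?f a) (at_right 0)" if a: "0 \<le> a" for a
  proof (rule tendstoI)
    fix e :: real assume e: "e > 0"
    obtain d where d: "d > 0" "\<And>t. t \<ge> 0 \<Longrightarrow> dist t a < d \<Longrightarrow> dist (?f t) (?f a) < e / 2"
      using continuous_on_rescaled[of \<mu> x] a e unfolding continuous_on_iff by (metis atLeast_iff half_gt_zero)
    have "dist ((1 / h) *\<^sub>R integral {a..a + h} ?f) (?f a) < e" if h: "0 < h" "h < d" for h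
    proof -
      have "norm (integral {a..a + h} (\<lambda>t. ?f t - ?f a)) \<le> e / 2 * (a + h - a)"
      proof (rule integral_bound)
        show "continuous_on {a..a + h} (\<lambda>t. ?f t - ?f a)"
          using a by (intro continuous_on_diff continuous_on_const continuous_on_subset[OF continuous_on_rescaled]) auto
        show "norm (?f t - ?f a) \<le> e / 2" if "t \<in> {a..a + h}" for t
          using d(2)[of t] that a h by (simp add: dist_norm)
      qed (use h in simp)
      also have "integral {a..a + h} (\<lambda>t. ?f t - ?f a) = h *\<^sub>R ((1 / h) *\<^sub>R integral {a..a + h} ?f - ?f a)"
        using h by (subst Henstock_Kurzweil_Integration.integral_diff[OF int[OF a]])
          (auto simp: scaleR_right_diff_distrib)
      finally show ?thesis using h e by (simp add: dist_norm)
    qed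
    then show "eventually (\<lambda>h. dist ((1 / h) *\<^sub>R integral {a..a + h} ?f) (?f a) < e) (at_right 0)"
      unfolding eventually_at_right_field using d(1) by blast
  qed
  have "((\<lambda>h. (1 / h) *\<^sub>R (rescaled \<mu> h v - v)) \<longlongrightarrow> ?f 1 - ?f 0) (at_right 0)"
  proof -
    have "((\<lambda>h. (1 / h) *\<^sub>R integral {1..1 + h} ?f - (1 / h) *\<^sub>R integral {0..0 + h} ?f)
        \<longlongrightarrow> ?f 1 - ?f 0) (at_right 0)"
      by (intro tendsto_diff right) auto
    moreover have "eventually (\<lambda>h. (1 / h) *\<^sub>R integral {1..1 + h} ?f - (1 / h) *\<^sub>R integral {0..0 + h} ?f
        = (1 / h) *\<^sub>R (rescaled \<mu> h v - v)) (at_right 0)"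
      using eventually_at_right_less[of 0]
    proof eventually_elim
      case (elim h)
      have bl: "bounded_linear (rescaled \<mu> h)"
        unfolding rescaled_def
        by (intro bounded_linear_compose[OF scaleC.bounded_linear_right] blinfun.bounded_linear_right)
      have "rescaled \<mu> h v = integral {0..1} (\<lambda>t. rescaled \<mu> h (?f t))"
        unfolding v_def using integral_linear[OF int bl, of 0 1] by (simp add: o_def)
      also have "\<dots> = integral {0..1} (\<lambda>t. ?f (t + h))"
        using elim by (intro integral_cong) (simp add: rescaled_add[symmetric] add.commute)
      also have "\<dots> = integral {h..1 + h} ?f"
        using integral_shift_Icc_real[of 0 1 ?f h] by (simp add: o_def add.commute)
      finally have 1: "rescaled \<mu> h v = integral {h..1 + h} ?f" .
      have 2: "integral {0..h} ?f + integral {h..1 + h} ?f = integral {0..1 + h} ?f"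
        using elim by (intro Henstock_Kurzweil_Integration.integral_combine int) auto
      have 3: "integral {0..1} ?f + integral {1..1 + h} ?f = integral {0..1 + h} ?f"
        using elim by (intro Henstock_Kurzweil_Integration.integral_combine int) auto
      have "rescaled \<mu> h v = integral {0..1 + h} ?f - integral {0..h} ?f"
        unfolding 1 2[symmetric] by simp
      moreover have "v = integral {0..1 + h} ?f - integral {1..1 + h} ?f"
        unfolding v_def 3[symmetric] by simp
      ultimately have "rescaled \<mu> h v - v = integral {1..1 + h} ?f - integral {0..h} ?f"
        by simp
      then show ?case by (simp add: scaleR_right_diff_distrib)
    qed
    ultimately show ?thesis by (rule Lim_transform_eventually)
  qed
  from unrescaled_quotient[OF this] show "v \<in> D" "shifted \<mu> v = x - rescaled \<mu> 1 x"
    by (simp_all add: shifted_def rescaled_0)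
qed

lemma range_shifted_UNIV:
  assumes "exp (- Re \<mu>) * norm (T 1) < 1"
  shows "shifted \<mu> ` D = UNIV"
proof -
  define c where "c = exp (- Re \<mu>) * norm (T 1)"
  have "w \<in> shifted \<mu> ` D" for w
  proof -
    have "dist (w + rescaled \<mu> 1 x) (w + rescaled \<mu> 1 y) \<le> c * dist x y" for x y
    proof -
      have "dist (w + rescaled \<mu> 1 x) (w + rescaled \<mu> 1 y) = norm (rescaled \<mu> 1 (x - y))"
        using linear_diff[OF linear_rescaled] by (simp add: dist_norm)
      also have "\<dots> = exp (- Re \<mu>) * norm (T 1 (x - y))" by (simp add: norm_rescaled)
      also have "\<dots> \<le> c * dist x y"
        unfolding c_def mult.assoc dist_norm by (intro mult_left_mono norm_blinfun) auto
      finally show ?thesis .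
    qed
    then have "\<exists>!x. w + rescaled \<mu> 1 x = x"
      using assms by (intro banach_fix_type[where c = c]) (auto simp: c_def)
    then obtain x where "w + rescaled \<mu> 1 x = x" by blast
    then have "x - rescaled \<mu> 1 x = w" by (metis add_diff_cancel_right')
    then show ?thesis using truncated_laplace[of \<mu> x] by (metis image_eqI)
  qed
  then show ?thesis by blast
qed

text \<open>If \<open>exp (Re \<mu>)\<close> is larger than \<open>norm (T 1) + 1\<close>, then \<open>T 1 v \<approx> exp \<mu> v\<close> forces \<open>v\<close> to be small, so
  approximate kernel vectors are caught near \<open>0\<close>.\<close>

lemma untrapped_Re_bounded:
  assumes "\<nexists>\<epsilon> \<theta> M. trapped \<mu> \<epsilon> \<theta> M"
  shows "exp (Re \<mu>) \<le> norm (T 1) + 1"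
proof (rule ccontr)
  assume contra: "\<not> ?thesis"
  obtain C where C: "C \<ge> 1" "\<And>s. 0 \<le> s \<Longrightarrow> s \<le> 1 \<Longrightarrow> norm (T s) \<le> C"
    using bounded_on_compact[of 1] by metis
  let ?c = "C * exp (2 * \<bar>Re \<mu>\<bar>)"
  have c: "?c > 0" using C(1) by simp
  have "trapped \<mu> (1 / (4 * ?c)) (1 / 4) {0}"
    unfolding trapped_def
  proof (intro conjI ballI impI)
    fix v assume v: "v \<in> D" "norm v \<le> 1" "norm (shifted \<mu> v) \<le> 1 / (4 * ?c)"
    have "norm (T 1 v - exp \<mu> *\<^sub>C v) \<le> ?c * norm (shifted \<mu> v)"
      using approximate_eigenvector_orbit[OF v(1) C(2), of 1 1 \<mu>] by simp
    also have "\<dots> \<le> ?c * (1 / (4 * ?c))" using c v(3) by (intro mult_left_mono) auto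
    also have "\<dots> = 1 / 4" using C(1) by simp
    finally have "norm (T 1 v - exp \<mu> *\<^sub>C v) \<le> 1 / 4" .
    moreover have "norm (exp \<mu> *\<^sub>C v) = exp (Re \<mu>) * norm v" by (simp add: norm_scaleC norm_exp_eq_Re)
    moreover have "norm (T 1 v) \<le> norm (T 1) * norm v" by (rule norm_blinfun)
    moreover have "norm (exp \<mu> *\<^sub>C v) \<le> norm (T 1 v) + norm (T 1 v - exp \<mu> *\<^sub>C v)"
      using norm_triangle_ineq4[of "T 1 v" "T 1 v - exp \<mu> *\<^sub>C v"] by simp
    moreover have "(norm (T 1) + 1) * norm v \<le> exp (Re \<mu>) * norm v"
      using contra by (intro mult_right_mono) auto
    ultimately have "norm v \<le> 1 / 4" by (simp add: algebra_simps)
    then show "\<exists>m\<in>{0}. norm (v - m) \<le> 1 / 4" by simp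
  qed (use c in auto)
  then show False using assms by blast
qed

end


section \<open>Compactness of the nonlinear part of a mild solution\<close>

text \<open>Riemann sums divided by the length of the interval are convex combinations of values of \<open>f\<close>.\<close>

lemma integral_mean_in_closed_convex:
  fixes f :: "real \<Rightarrow> 'a::banach"
  assumes int: "f integrable_on {a..b}" and ab: "a < b"
    and S: "convex S" "closed S" "\<And>t. t \<in> {a..b} \<Longrightarrow> f t \<in> S"
  shows "(1 / (b - a)) *\<^sub>R integral {a..b} f \<in> S"
proof -
  let ?I = "integral {a..b} f"
  have "\<exists>s\<in>S. dist s ((1 / (b - a)) *\<^sub>R ?I) < e" if e: "e > 0" for e
  proof -
    have "(f has_integral ?I) (cbox a b)" using int by (simp add: integrable_integral)
    moreover have "e * (b - a) > 0" using e ab by simp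
    ultimately obtain \<gamma> where \<gamma>: "gauge \<gamma>"
      "\<And>p. p tagged_division_of (cbox a b) \<Longrightarrow> \<gamma> fine p \<Longrightarrow>
        norm ((\<Sum>(x, k)\<in>p. measure lborel k *\<^sub>R f x) - ?I) < e * (b - a)"
      unfolding has_integral by metis
    obtain p where p: "p tagged_division_of (cbox a b)" "\<gamma> fine p"
      using fine_division_exists[OF \<gamma>(1)] by blast
    define s where "s = (\<Sum>xk\<in>p. (measure lborel (snd xk) / (b - a)) *\<^sub>R f (fst xk))"
    have "s \<in> S" unfolding s_def
    proof (rule convex_sum)
      show "finite p" using p(1) by (rule tagged_division_of_finite)
      have "(\<Sum>xk\<in>p. measure lborel (snd xk)) = b - a"
        using additive_content_tagged_division[OF p(1)] ab by (simp add: case_prod_unfold)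
      then show "(\<Sum>xk\<in>p. measure lborel (snd xk) / (b - a)) = 1"
        using ab by (simp add: sum_divide_distrib[symmetric])
      show "f (fst xk) \<in> S" if "xk \<in> p" for xk
        using tagged_division_ofD(2,3)[OF p(1), of "fst xk" "snd xk"] that S(3) by auto
    qed (use S ab in \<open>auto simp: content_pos_le\<close>)
    moreover have "s - (1 / (b - a)) *\<^sub>R ?I
        = (1 / (b - a)) *\<^sub>R ((\<Sum>(x, k)\<in>p. measure lborel k *\<^sub>R f x) - ?I)"
      by (simp add: s_def scaleR_right_diff_distrib scaleR_sum_right case_prod_unfold)
    then have "dist s ((1 / (b - a)) *\<^sub>R ?I) < e"
      using \<gamma>(2)[OF p] ab by (simp add: dist_norm pos_divide_less_eq)
    ultimately show ?thesis by blast
  qed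
  then have "(1 / (b - a)) *\<^sub>R ?I \<in> closure S" by (simp add: closure_approachable)
  then show ?thesis using S(2) by simp
qed

lemma small_cover_if_near_compact:
  fixes N :: "'a::metric_space set"
  assumes N: "compact N" and near: "\<And>x. x \<in> W \<Longrightarrow> \<exists>n\<in>N. dist x n \<le> e" and d: "2 * e < d"
  shows "small_cover d W"
proof -
  have "(d - 2 * e) / 2 > 0" using d by simp
  then obtain k where k: "finite k" "N \<subseteq> (\<Union>c\<in>k. ball c ((d - 2 * e) / 2))"
    using N unfolding compact_eq_totally_bounded by blast
  have "W \<subseteq> \<Union>((\<lambda>c. cball c (d / 2)) ` k)"
  proof
    fix x assume "x \<in> W"
    then obtain n where n: "n \<in> N" "dist x n \<le> e" using near by blast
    then obtain c where c: "c \<in> k" "dist c n < (d - 2 * e) / 2" using k by auto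
    have "dist c x \<le> d / 2" using dist_triangle2[of c x n] n c by (simp add: field_simps)
    then show "x \<in> \<Union>((\<lambda>c. cball c (d / 2)) ` k)" using c(1) by auto
  qed
  moreover have "dist x y \<le> d" if "x \<in> cball c (d / 2)" "y \<in> cball c (d / 2)" for x y c
    using that dist_triangle3[of x y c] by simp
  ultimately show ?thesis
    unfolding small_cover_def using k(1) by (intro exI[of _ "(\<lambda>c. cball c (d / 2)) ` k"]) auto
qed

text \<open>Up to a small error the integrand takes values in the convex hull of a finite net of \<open>Q\<close>,
  which is compact; hence so does every mean value of the integrand.\<close>

lemma compact_closure_integrals:
  fixes Q :: "'a::banach set" and \<tau> :: real
  assumes Q: "compact Q"
  shows "compact (closure {integral {0..t} f |t f. 0 \<le> t \<and> t \<le> \<tau> \<and> continuous_on {0..t} f \<and> f ` {0..t} \<subseteq> Q})"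
    (is "compact (closure ?W)")
proof (rule compact_closure_if_small_covers)
  fix d :: real assume d: "d > 0"
  define \<eta> where "\<eta> = d / (4 * (\<bar>\<tau>\<bar> + 1))"
  have \<eta>: "\<eta> > 0" using d by (simp add: \<eta>_def)
  then obtain F where F: "finite F" "Q \<subseteq> (\<Union>c\<in>F. ball c \<eta>)"
    using Q unfolding compact_eq_totally_bounded by blast
  let ?H = "convex hull F"
  have H: "compact ?H" using F(1) by (rule finite_imp_compact_convex_hull)
  define N where "N = (\<lambda>(t, p). t *\<^sub>R p) ` ({0..\<tau>} \<times> ?H)"
  define S where "S = (\<Union>p\<in>?H. \<Union>e\<in>cball 0 \<eta>. {p + e})"
  have S: "convex S" "closed S"
  proof -
    show "convex S"
      unfolding S_def by (intro convex_sums convex_convex_hull convex_cball)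
    show "closed S"
      unfolding S_def by (intro compact_closed_sums H closed_cball)
  qed
  show "small_cover d ?W"
  proof (rule small_cover_if_near_compact)
    show "compact N"
      unfolding N_def case_prod_unfold
      by (intro compact_continuous_image continuous_intros compact_Times compact_Icc H)
    show "2 * (\<bar>\<tau>\<bar> * \<eta>) < d"
    proof -
      have "2 * (\<bar>\<tau>\<bar> * \<eta>) = d * (\<bar>\<tau>\<bar> / (2 * (\<bar>\<tau>\<bar> + 1)))" by (simp add: \<eta>_def field_simps)
      also have "\<dots> < d * 1" using d by (intro mult_strict_left_mono) (auto simp: field_simps)
      finally show ?thesis by simp
    qed
    fix x assume "x \<in> ?W"
    then obtain t f where tf: "x = integral {0..t} f" "0 \<le> t" "t \<le> \<tau>" "continuous_on {0..t} f"
      "f ` {0..t} \<subseteq> Q" by blast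
    have net: "\<exists>c\<in>F. dist c (f s) < \<eta>" if "s \<in> {0..t}" for s using that F tf(5) by fastforce
    have "\<exists>p\<in>?H. dist x (t *\<^sub>R p) \<le> t * \<eta>"
    proof (cases "t = 0")
      case True
      obtain c where "c \<in> F" using net[of 0] tf(2) by auto
      then show ?thesis using True tf(1) by (intro bexI[of _ c]) (auto simp: hull_inc)
    next
      case False
      have "(1 / (t - 0)) *\<^sub>R integral {0..t} f \<in> S"
      proof (rule integral_mean_in_closed_convex[OF _ _ S])
        show "f integrable_on {0..t}" using tf(4) by (rule integrable_continuous_real)
        fix s assume "s \<in> {0..t}"
        then obtain c where "c \<in> F" "dist c (f s) < \<eta>" using net by blast
        then show "f s \<in> S"
          unfolding S_def by (intro UN_I[of c] UN_I[of "f s - c"])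
            (auto simp: hull_inc dist_norm norm_minus_commute)
      qed (use False tf(2) in simp)
      then obtain p e where pe: "p \<in> ?H" "norm e \<le> \<eta>" "(1 / t) *\<^sub>R x = p + e"
        by (auto simp: S_def tf(1))
      then have "t *\<^sub>R (p + e) = t *\<^sub>R ((1 / t) *\<^sub>R x)" by simp
      then have "x - t *\<^sub>R p = t *\<^sub>R e" using False by (simp add: scaleR_add_right algebra_simps)
      then show ?thesis using pe(1,2) tf(2) by (intro bexI[of _ p]) (auto simp: dist_norm mult_left_mono)
    qed
    then obtain p where p: "p \<in> ?H" "dist x (t *\<^sub>R p) \<le> t * \<eta>" by blast
    moreover have "t * \<eta> \<le> \<bar>\<tau>\<bar> * \<eta>" using tf(3) \<eta> by (intro mult_right_mono) auto
    moreover have "t *\<^sub>R p \<in> N" using p(1) tf(2,3) by (force simp: N_def)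
    ultimately show "\<exists>n\<in>N. dist x n \<le> \<bar>\<tau>\<bar> * \<eta>" by force
  qed
qed

context locally_bounded_semigroup
begin

lemma continuous_on_mild_integrand:
  assumes K: "continuous_on ({0..} \<times> UNIV) (\<lambda>(t, z). K t z)" and u: "continuous_on {0..} u"
  shows "continuous_on {0..t} (\<lambda>s. T (t - s) (K s (u s)))"
proof (rule continuous_on_orbit)
  have "continuous_on {0..t} (\<lambda>s. (s, u s))"
    by (intro continuous_intros continuous_on_subset[OF u]) auto
  from continuous_on_compose2[OF K this] show "continuous_on {0..t} (\<lambda>s. K s (u s))" by force
qed (auto intro!: continuous_intros)

lemma mild_solution_compact_part:
  fixes u :: "'a \<Rightarrow> real \<Rightarrow> 'a"
  assumes K: "continuous_on ({0..} \<times> UNIV) (\<lambda>(t, z). K t z)" "maps_bounded_to_precompact K"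
    and sol: "\<And>x0. x0 \<in> B \<Longrightarrow> mild_solution T K x0 (u x0)"
    and bd: "bounded {u x0 t |t x0. 0 \<le> t \<and> t \<le> \<tau> \<and> x0 \<in> B}"
  obtains Q where "compact Q" "\<And>x0 t. x0 \<in> B \<Longrightarrow> 0 \<le> t \<Longrightarrow> t \<le> \<tau> \<Longrightarrow> \<exists>q\<in>Q. u x0 t = T t x0 + q"
proof -
  define S where "S = {u x0 t |t x0. 0 \<le> t \<and> t \<le> \<tau> \<and> x0 \<in> B}"
  define \<kappa> where "\<kappa> = closure ((\<lambda>(t, x). K t x) ` ({0..\<tau>} \<times> S))"
  have "{0..\<tau>} \<times> S \<subseteq> {0..} \<times> UNIV" "bounded ({0..\<tau>} \<times> S)"
    using bd by (auto intro: bounded_Times simp flip: S_def)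
  then have \<kappa>: "compact \<kappa>"
    using K(2) unfolding maps_bounded_to_precompact_def \<kappa>_def by blast
  define Q1 where "Q1 = (\<lambda>(t, x). T t x) ` ({0..\<tau>} \<times> \<kappa>)"
  have Q1: "compact Q1"
    unfolding Q1_def
    by (intro compact_continuous_image continuous_on_subset[OF continuous_on_flow] compact_Times compact_Icc \<kappa>)
      auto
  let ?W = "{integral {0..t} f |t f. 0 \<le> t \<and> t \<le> \<tau> \<and> continuous_on {0..t} f \<and> f ` {0..t} \<subseteq> Q1}"
  show thesis
  proof (rule that)
    show "compact (closure ?W)" by (rule compact_closure_integrals[OF Q1])
    fix x0 t assume x0: "x0 \<in> B" and t: "0 \<le> t" "t \<le> \<tau>"
    let ?f = "\<lambda>s. T (t - s) (K s (u x0 s))"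
    have u: "continuous_on {0..} (u x0)" "u x0 t = T t x0 + integral {0..t} ?f"
      using sol[OF x0] t by (auto simp: mild_solution_def)
    have "?f s \<in> Q1" if s: "s \<in> {0..t}" for s
    proof -
      have "K s (u x0 s) \<in> (\<lambda>(t, x). K t x) ` ({0..\<tau>} \<times> S)"
      proof (rule image_eqI)
        have "u x0 s \<in> S"
          unfolding S_def using s t x0 by (intro CollectI exI[of _ s] exI[of _ x0]) simp
        then show "(s, u x0 s) \<in> {0..\<tau>} \<times> S" using s t by simp
      qed simp
      then have "K s (u x0 s) \<in> \<kappa>" unfolding \<kappa>_def by (rule subsetD[OF closure_subset])
      then show ?thesis
        unfolding Q1_def using s t by (intro image_eqI[of _ _ "(t - s, K s (u x0 s))"]) auto
    qed
    then have "integral {0..t} ?f \<in> ?W"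
      using t continuous_on_mild_integrand[OF K(1) u(1)]
      by (intro CollectI exI[of _ t] exI[of _ ?f]) (simp add: image_subset_iff)
    then have "integral {0..t} ?f \<in> closure ?W" by (rule subsetD[OF closure_subset])
    then show "\<exists>q\<in>closure ?W. u x0 t = T t x0 + q" using u(2) by blast
  qed
qed

end


section \<open>Orbits that grow in spite of compact perturbations\<close>

context closed_operator
begin

text \<open>The eigenvalue may depend on \<open>\<eta>\<close> and \<open>M\<close>: it is not fixed in either application, where its
  imaginary part tends to infinity or its real part approaches a supremum.\<close>

definition escaping_eigenvectors :: "real \<Rightarrow> real \<Rightarrow> bool" where
  "escaping_eigenvectors \<omega> \<theta> \<longleftrightarrow> (\<forall>\<eta>>0. \<forall>M. compact M \<longrightarrow>
     (\<exists>\<mu>. \<exists>z\<in>D. \<bar>Re \<mu> - \<omega>\<bar> < \<eta> \<and> norm z = 1 \<and> norm (shifted \<mu> z) < \<eta> \<and> (\<forall>m\<in>M. \<theta> \<le> norm (z - m))))"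

text \<open>Being far from the cone over \<open>M\<close> with apex \<open>0\<close> ensures that the vector is not short and, after
  normalisation, is still far from \<open>M\<close>.\<close>

lemma untrapped_escape:
  assumes un: "\<nexists>\<epsilon> \<theta> M. trapped \<mu> \<epsilon> \<theta> M" and \<theta>: "0 < \<theta>" "\<theta> < 1 / 2" and \<eta>: "\<eta> > 0" and M: "compact M"
  shows "\<exists>z\<in>D. norm z = 1 \<and> norm (shifted \<mu> z) < \<eta> \<and> (\<forall>m\<in>M. \<theta> \<le> norm (z - m))"
proof -
  define N where "N = (\<lambda>(s, m). s *\<^sub>R m) ` ({0..1::real} \<times> insert 0 M)"
  have "compact N"
    unfolding N_def case_prod_unfold
    by (intro compact_continuous_image continuous_intros compact_Times compact_Icc compact_insert M)
  moreover have "\<not> trapped \<mu> (\<eta> * \<theta> / 2) \<theta> N" using un by blast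
  ultimately obtain v where v: "v \<in> D" "norm v \<le> 1" "norm (shifted \<mu> v) \<le> \<eta> * \<theta> / 2"
    "\<And>m. m \<in> N \<Longrightarrow> \<theta> < norm (v - m)"
    unfolding trapped_def using \<eta> \<theta> by (auto simp: not_le)
  have "0 \<in> N" unfolding N_def by (intro image_eqI[of _ _ "(0, 0)"]) auto
  then have nv: "\<theta> < norm v" using v(4) by force
  define z where "z = (1 / norm v) *\<^sub>R v"
  have vz: "v = norm v *\<^sub>R z" using nv \<theta> by (simp add: z_def)
  have "norm (shifted \<mu> z) = norm (shifted \<mu> v) / norm v"
    using v(1) by (simp add: z_def shifted_scaleR)
  also have "\<dots> \<le> (\<eta> * \<theta> / 2) / \<theta>" using v(3) nv \<theta> \<eta> by (intro frac_le) auto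
  also have "\<dots> < \<eta>" using \<theta> \<eta> by simp
  finally have "norm (shifted \<mu> z) < \<eta>" .
  moreover have "\<theta> \<le> norm (z - m)" if m: "m \<in> M" for m
  proof -
    have "norm v *\<^sub>R m \<in> N"
      unfolding N_def using m v(2) by (intro image_eqI[of _ _ "(norm v, m)"]) auto
    then have "\<theta> < norm (norm v *\<^sub>R z - norm v *\<^sub>R m)" using v(4) vz by metis
    also have "\<dots> = norm v * norm (z - m)" by (simp flip: scaleR_right_diff_distrib)
    also have "\<dots> \<le> norm (z - m)" using v(2) by (simp add: mult_left_le_one_le)
    finally show ?thesis by simp
  qed
  moreover have "z \<in> D" "norm z = 1" using v(1) nv \<theta> by (auto simp: z_def dom_scaleR)
  ultimately show ?thesis by blast
qed

end

context locally_bounded_semigroup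
begin

text \<open>Up to a small error, \<open>c T t z + q = c exp (\<mu> t) (z - \<zeta> q)\<close> with \<open>\<zeta> = - exp (- \<mu> t) / c\<close>. The
  numbers \<open>\<zeta>\<close> that occur are bounded by some \<open>R\<close> known before \<open>\<mu>\<close> is, so \<open>z\<close> can be chosen at
  distance \<open>\<theta>'\<close> from the compact set of all these \<open>\<zeta> q\<close>.\<close>

lemma escaping_direction:
  assumes esc: "escaping_eigenvectors \<omega> \<theta>'" and \<theta>: "0 \<le> \<theta>" "\<theta> < \<theta>'" and \<tau>: "0 \<le> \<tau>" and c: "c > 0"
    and Q: "compact Q"
  shows "\<exists>z. norm z = 1 \<and> (\<forall>t\<in>{0..\<tau>}. norm (T t z) \<le> 2 * exp (\<omega> * t) \<and>
    (\<forall>q\<in>Q. c * \<theta> * exp (\<omega> * t) \<le> norm (c *\<^sub>R T t z + q)))"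
proof -
  obtain C where C: "C \<ge> 1" "\<And>s. 0 \<le> s \<Longrightarrow> s \<le> \<tau> \<Longrightarrow> norm (T s) \<le> C"
    using bounded_on_compact[of \<tau>] by metis
  \<comment> \<open>the relative error \<open>\<epsilon>\<close> lowers the constant from \<open>\<theta>'\<close> to \<open>(1 - \<epsilon>) \<theta>' - \<epsilon> \<ge> \<theta>\<close>\<close>
  define \<epsilon> where "\<epsilon> = min (1 / 2) ((\<theta>' - \<theta>) / (\<theta>' + 1))"
  have "(\<theta>' - \<theta>) / (\<theta>' + 1) > 0" using \<theta> by simp
  then have \<epsilon>: "\<epsilon> > 0" "\<epsilon> \<le> 1 / 2" "\<epsilon> \<le> (\<theta>' - \<theta>) / (\<theta>' + 1)"
    unfolding \<epsilon>_def by linarith+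
  then have gap: "\<theta> \<le> (1 - \<epsilon>) * \<theta>' - \<epsilon>" using \<theta> by (simp add: field_simps)
  define G where "G = \<tau> * C * exp (2 * (\<bar>\<omega>\<bar> + 1) * \<tau>)"
  have G: "G \<ge> 0" using \<tau> C(1) by (simp add: G_def)
  \<comment> \<open>in the order of the bounds: \<open>\<bar>Re \<mu>\<bar> \<le> \<bar>\<omega>\<bar> + 1\<close>; \<open>exp (Re \<mu> t)\<close> and \<open>exp (\<omega> t)\<close> agree up to a factor \<open>1 \<plusminus> \<epsilon>\<close>; the orbit error is at most \<open>\<epsilon> exp (\<omega> t)\<close>\<close>
  define \<eta> where "\<eta> = min (min 1 (ln (1 + \<epsilon>) / (\<tau> + 1))) (\<epsilon> * exp (- \<bar>\<omega>\<bar> * \<tau>) / (G + 1))"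
  have "ln (1 + \<epsilon>) / (\<tau> + 1) > 0" using \<epsilon> \<tau> by simp
  moreover have "\<epsilon> * exp (- \<bar>\<omega>\<bar> * \<tau>) / (G + 1) > 0" using \<epsilon> G by simp
  ultimately have \<eta>: "\<eta> > 0" "\<eta> \<le> 1" "\<eta> \<le> ln (1 + \<epsilon>) / (\<tau> + 1)" "\<eta> \<le> \<epsilon> * exp (- \<bar>\<omega>\<bar> * \<tau>) / (G + 1)"
    unfolding \<eta>_def by linarith+
  have \<eta>\<tau>: "\<eta> * \<tau> \<le> ln (1 + \<epsilon>)"
  proof -
    have "\<eta> * \<tau> \<le> \<eta> * (\<tau> + 1)" using \<eta>(1) by simp
    also have "\<dots> \<le> ln (1 + \<epsilon>)" using \<eta>(3) \<tau> by (simp add: pos_le_divide_eq)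
    finally show ?thesis .
  qed
  have \<eta>G: "G * \<eta> \<le> \<epsilon> * exp (- \<bar>\<omega>\<bar> * \<tau>)"
  proof -
    have "G * \<eta> \<le> \<eta> * (G + 1)" using \<eta>(1) by (simp add: algebra_simps)
    also have "\<dots> \<le> \<epsilon> * exp (- \<bar>\<omega>\<bar> * \<tau>)" using \<eta>(4) G by (simp add: pos_le_divide_eq)
    finally show ?thesis .
  qed
  define R where "R = exp ((\<bar>\<omega>\<bar> + 1) * \<tau>) / c"
  define M where "M = (\<lambda>(\<zeta>, q). \<zeta> *\<^sub>C q) ` (cball (0::complex) R \<times> Q)"
  have M: "compact M"
    unfolding M_def case_prod_unfold
    by (intro compact_continuous_image scaleC.continuous_on continuous_intros compact_Times compact_cball Q)
  obtain \<mu> z where z: "z \<in> D" "\<bar>Re \<mu> - \<omega>\<bar> < \<eta>" "norm z = 1" "norm (shifted \<mu> z) < \<eta>"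
    "\<And>m. m \<in> M \<Longrightarrow> \<theta>' \<le> norm (z - m)"
    using esc \<eta>(1) M unfolding escaping_eigenvectors_def by meson
  have "norm (T t z) \<le> 2 * exp (\<omega> * t) \<and> (\<forall>q\<in>Q. c * \<theta> * exp (\<omega> * t) \<le> norm (c *\<^sub>R T t z + q))"
    if t: "0 \<le> t" "t \<le> \<tau>" for t
  proof -
    let ?w = "exp (\<omega> * t)" and ?e = "exp (\<mu> * complex_of_real t)"
    have wt: "exp (- \<bar>\<omega>\<bar> * \<tau>) \<le> ?w"
    proof -
      have "\<bar>\<omega> * t\<bar> \<le> \<bar>\<omega>\<bar> * \<tau>" unfolding abs_mult using t by (intro mult_mono) auto
      then show ?thesis by auto
    qed
    have "\<bar>Re \<mu>\<bar> \<le> \<bar>\<omega>\<bar> + 1" using z(2) \<eta>(2) by linarith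
    then have "\<tau> * C * exp (2 * \<bar>Re \<mu>\<bar> * \<tau>) \<le> G"
      unfolding G_def using \<tau> C(1) by (intro mult_left_mono) (auto intro: mult_right_mono)
    then have "\<tau> * C * exp (2 * \<bar>Re \<mu>\<bar> * \<tau>) * norm (shifted \<mu> z) \<le> G * \<eta>"
      using z(4) G by (intro mult_mono) auto
    then have err: "norm (T t z - ?e *\<^sub>C z) \<le> \<epsilon> * ?w"
      using approximate_eigenvector_orbit[OF z(1) C(2) t, of \<mu>] \<eta>G mult_left_mono[OF wt, of \<epsilon>] \<epsilon>(1)
      by linarith
    have ne: "norm ?e = ?w * exp ((Re \<mu> - \<omega>) * t)"
      by (simp add: norm_exp_eq_Re algebra_simps flip: exp_add)
    have dt: "\<bar>(Re \<mu> - \<omega>) * t\<bar> \<le> ln (1 + \<epsilon>)"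
    proof -
      have "\<bar>(Re \<mu> - \<omega>) * t\<bar> \<le> \<eta> * \<tau>" unfolding abs_mult using t z(2) by (intro mult_mono) auto
      then show ?thesis using \<eta>\<tau> by linarith
    qed
    have up: "norm ?e \<le> (1 + \<epsilon>) * ?w"
    proof -
      have "exp ((Re \<mu> - \<omega>) * t) \<le> exp (ln (1 + \<epsilon>))" using dt by simp
      then have "exp ((Re \<mu> - \<omega>) * t) \<le> 1 + \<epsilon>" using \<epsilon>(1) by simp
      then show ?thesis unfolding ne by (simp add: mult.commute[of ?w] mult_right_mono)
    qed
    have low: "(1 - \<epsilon>) * ?w \<le> norm ?e"
    proof -
      have "(1 - \<epsilon>) * (1 + \<epsilon>) \<le> 1" by (simp add: algebra_simps)
      then have "1 - \<epsilon> \<le> inverse (1 + \<epsilon>)" using \<epsilon>(1) by (simp add: field_simps)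
      also have "\<dots> = exp (- ln (1 + \<epsilon>))" using \<epsilon>(1) by (simp add: exp_minus)
      also have "\<dots> \<le> exp ((Re \<mu> - \<omega>) * t)" using dt by (simp add: abs_le_iff)
      finally show ?thesis unfolding ne by (simp add: mult.commute[of ?w] mult_right_mono)
    qed
    have "norm (T t z) \<le> norm (?e *\<^sub>C z) + norm (T t z - ?e *\<^sub>C z)"
      using norm_triangle_ineq[of "?e *\<^sub>C z" "T t z - ?e *\<^sub>C z"] by simp
    also have "\<dots> \<le> (1 + \<epsilon>) * ?w + \<epsilon> * ?w" using up err z(3) by (simp add: norm_scaleC)
    also have "\<dots> = (1 + 2 * \<epsilon>) * ?w" by (simp add: algebra_simps)
    also have "\<dots> \<le> 2 * ?w" using \<epsilon>(2) by (intro mult_right_mono) auto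
    finally have growth: "norm (T t z) \<le> 2 * ?w" .
    have "c * \<theta> * ?w \<le> norm (c *\<^sub>R T t z + q)" if q: "q \<in> Q" for q
    proof -
      define \<zeta> where "\<zeta> = - exp (- \<mu> * complex_of_real t) / complex_of_real c"
      have "norm \<zeta> \<le> R"
      proof -
        have "- Re \<mu> * t \<le> \<bar>Re \<mu> * t\<bar>" by simp
        also have "\<dots> \<le> (\<bar>\<omega>\<bar> + 1) * \<tau>"
          unfolding abs_mult using t \<open>\<bar>Re \<mu>\<bar> \<le> \<bar>\<omega>\<bar> + 1\<close> by (intro mult_mono) auto
        finally show ?thesis
          using c by (simp add: \<zeta>_def R_def norm_divide norm_exp_eq_Re divide_right_mono)
      qed
      then have "\<zeta> *\<^sub>C q \<in> M"
        unfolding M_def using q by (intro image_eqI[of _ _ "(\<zeta>, q)"]) auto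
      then have far: "\<theta>' \<le> norm (z - \<zeta> *\<^sub>C q)" using z(5) by blast
      have "complex_of_real c * ?e * \<zeta> = - 1"
        using c by (simp add: \<zeta>_def field_simps flip: exp_add)
      then have "(complex_of_real c * ?e) *\<^sub>C (z - \<zeta> *\<^sub>C q) = c *\<^sub>R (?e *\<^sub>C z) + q"
        by (simp add: scaleC.diff_right scaleC_scaleC scaleC.minus_left scaleC_one flip: scaleC_of_real)
      then have eq: "c *\<^sub>R T t z + q
          = (complex_of_real c * ?e) *\<^sub>C (z - \<zeta> *\<^sub>C q) + c *\<^sub>R (T t z - ?e *\<^sub>C z)"
        by (simp add: scaleR_right_diff_distrib)
      have "(1 - \<epsilon>) * ?w * \<theta>' \<le> norm ?e * norm (z - \<zeta> *\<^sub>C q)"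
        using low far \<theta> \<epsilon> by (intro mult_mono) auto
      then have "c * ((1 - \<epsilon>) * ?w * \<theta>') \<le> norm ((complex_of_real c * ?e) *\<^sub>C (z - \<zeta> *\<^sub>C q))"
        using c by (simp add: norm_scaleC norm_mult mult.assoc)
      moreover have "norm (c *\<^sub>R (T t z - ?e *\<^sub>C z)) \<le> c * (\<epsilon> * ?w)"
        using err c by (simp add: mult_left_mono)
      ultimately have "c * ((1 - \<epsilon>) * ?w * \<theta>') - c * (\<epsilon> * ?w) \<le> norm (c *\<^sub>R T t z + q)"
        unfolding eq using norm_diff_ineq[of "(complex_of_real c * ?e) *\<^sub>C (z - \<zeta> *\<^sub>C q)" "c *\<^sub>R (T t z - ?e *\<^sub>C z)"]
        by linarith
      moreover have "c * \<theta> * ?w \<le> c * ((1 - \<epsilon>) * \<theta>' - \<epsilon>) * ?w"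
        using gap c by (intro mult_right_mono mult_left_mono) auto
      ultimately show ?thesis by (simp add: algebra_simps)
    qed
    then show ?thesis using growth by blast
  qed
  then show ?thesis using z(3) by auto
qed

text \<open>The initial value is the limit of \<open>X k = y + (\<Sum>i<k. w i)\<close>, where \<open>w k\<close> has norm \<open>c k = c0 \<rho> ^ k\<close>
  and its direction is chosen by \<open>escaping_direction\<close> to protect the times between \<open>\<sigma> k\<close> and
  \<open>\<sigma> (Suc k)\<close> against the compact set formed by \<open>T t (X k) + q\<close>. The later terms contribute at most
  \<open>2 exp (\<omega> t)\<close> times the sum of their coefficients, since their directions are also controlled at
  these earlier times. What remains is at least \<open>\<rho> ^ k G exp (\<omega> t)\<close>.\<close>

lemma growing_orbit:
  assumes esc: "escaping_eigenvectors \<omega> \<theta>'"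
    and a: "\<And>t. t \<ge> 0 \<Longrightarrow> a t \<ge> 0" "antimono_on {0..} a" "(a \<longlongrightarrow> 0) at_top"
    and r: "r > 0" and t0: "t0 \<ge> 0" and at0: "a t0 < r * \<theta>'"
    and Q: "\<And>\<tau>::real. compact (Q \<tau>)"
  shows "\<exists>x0\<in>cball y r. \<forall>t\<ge>t0. \<exists>\<tau>\<ge>t. \<forall>q\<in>Q \<tau>. a t * exp (\<omega> * t) \<le> norm (T t x0 + q)"
proof -
  have "a t0 / r < \<theta>'" using at0 r by (simp add: field_simps)
  then obtain \<theta> where \<theta>: "a t0 / r < \<theta>" "\<theta> < \<theta>'" using dense by blast
  moreover have "0 \<le> a t0 / r" using a(1)[OF t0] r by simp
  ultimately have \<theta>: "0 < \<theta>" "\<theta> < \<theta>'" "a t0 / r < \<theta>" by auto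
  have "a t0 / \<theta> < r" using \<theta> r by (simp add: field_simps)
  then obtain c0 where "a t0 / \<theta> < c0" "c0 < r" using dense by blast
  moreover have "0 \<le> a t0 / \<theta>" using \<theta> a(1)[OF t0] by simp
  ultimately have c0: "0 < c0" "c0 < r" "a t0 / \<theta> < c0" by auto
  then have c0\<theta>: "a t0 < c0 * \<theta>" using \<theta> by (simp add: field_simps)
  \<comment> \<open>the second bound keeps the sum of all \<open>c k\<close> at most \<open>r\<close>, the third makes \<open>G\<close> exceed \<open>a t0\<close>\<close>
  define \<rho> where "\<rho> = min (1 / 2) (min ((r - c0) / (2 * c0)) ((c0 * \<theta> - a t0) / (8 * c0)))"
  have "(r - c0) / (2 * c0) > 0" "(c0 * \<theta> - a t0) / (8 * c0) > 0" using c0 c0\<theta> by auto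
  then have \<rho>: "0 < \<rho>" "\<rho> \<le> 1 / 2" "\<rho> \<le> (r - c0) / (2 * c0)" "\<rho> \<le> (c0 * \<theta> - a t0) / (8 * c0)"
    unfolding \<rho>_def by linarith+
  define G where "G = c0 * \<theta> - 4 * c0 * \<rho>"
  have "8 * c0 * \<rho> \<le> c0 * \<theta> - a t0" using \<rho>(4) c0 by (simp add: field_simps)
  moreover have "c0 * \<rho> > 0" using c0 \<rho> by simp
  ultimately have G: "a t0 \<le> G" "0 < G" using a(1)[OF t0] c0\<theta> by (auto simp: G_def)
  have geo: "1 / (1 - \<rho>) \<le> 1 + 2 * \<rho>" "1 / (1 - \<rho>) \<le> 2"
  proof -
    have "\<rho> * (2 * \<rho>) \<le> \<rho> * 1" using \<rho> by (intro mult_left_mono) auto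
    then show "1 / (1 - \<rho>) \<le> 1 + 2 * \<rho>" using \<rho> by (simp add: divide_le_eq algebra_simps)
    then show "1 / (1 - \<rho>) \<le> 2" using \<rho> by simp
  qed
  define c where "c k = c0 * \<rho> ^ k" for k
  have c: "c k > 0" for k using c0 \<rho> by (simp add: c_def)
  have c_sums: "(\<lambda>i. c (i + k)) sums (c k * (1 / (1 - \<rho>)))" for k
    using sums_mult[OF geometric_sums[of \<rho>], of "c k"] \<rho> by (simp add: c_def power_add mult_ac)

  \<comment> \<open>times after which \<open>a\<close> is smaller than what the \<open>k\<close>-th term guarantees\<close>
  have "\<exists>b. \<forall>t\<ge>b. a t \<le> \<rho> ^ k * G" for k
  proof -
    have "eventually (\<lambda>t. a t < \<rho> ^ k * G) at_top"
      using \<rho> G by (intro order_tendstoD(2)[OF a(3)]) auto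
    then show ?thesis unfolding eventually_at_top_linorder by (meson less_imp_le)
  qed
  then obtain b where b: "\<And>k t. t \<ge> b k \<Longrightarrow> a t \<le> \<rho> ^ k * G" by metis
  define \<sigma> where "\<sigma> k = t0 + (\<Sum>i=1..k. \<bar>b i\<bar> + 1)" for k
  have \<sigma>_Suc: "\<sigma> (Suc k) = \<sigma> k + (\<bar>b (Suc k)\<bar> + 1)" for k by (simp add: \<sigma>_def)
  have \<sigma>_mono: "\<sigma> j \<le> \<sigma> k" if "j \<le> k" for j k
    using lift_Suc_mono_le[of \<sigma>, OF _ that] \<sigma>_Suc by simp
  have \<sigma>0: "\<sigma> 0 = t0" by (simp add: \<sigma>_def)
  then have \<sigma>_nonneg: "0 \<le> \<sigma> k" for k using \<sigma>_mono[of 0 k] t0 by simp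
  have \<sigma>_real: "real k \<le> \<sigma> k" for k by (induction k) (use t0 \<sigma>0 \<sigma>_Suc in auto)
  have a\<sigma>: "a (\<sigma> k) \<le> \<rho> ^ k * G" for k
  proof (cases k)
    case 0
    then show ?thesis using G(1) \<sigma>0 by simp
  next
    case (Suc j)
    then have "b k \<le> \<sigma> k" using \<sigma>_Suc[of j] \<sigma>_nonneg[of j] by simp
    then show ?thesis by (rule b)
  qed

  \<comment> \<open>the direction \<open>z\<close> is suitable for step \<open>k\<close> if the sum built so far is \<open>p\<close>\<close>
  define P where "P k p z \<longleftrightarrow> norm z = 1 \<and> (\<forall>t\<in>{0..\<sigma> (Suc k)}. norm (T t z) \<le> 2 * exp (\<omega> * t) \<and>
    (\<forall>q\<in>Q (\<sigma> (Suc k)). c k * \<theta> * exp (\<omega> * t) \<le> norm (c k *\<^sub>R T t z + (T t p + q))))" for k p z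
  have "\<exists>z. P k p z" for k p
  proof -
    let ?Q = "(\<lambda>(s, q). T s p + q) ` ({0..\<sigma> (Suc k)} \<times> Q (\<sigma> (Suc k)))"
    have "compact ?Q"
      unfolding case_prod_unfold
      by (intro compact_continuous_image continuous_intros compact_Times compact_Icc Q) auto
    then have "\<exists>z. norm z = 1 \<and> (\<forall>t\<in>{0..\<sigma> (Suc k)}. norm (T t z) \<le> 2 * exp (\<omega> * t) \<and>
       (\<forall>q\<in>?Q. c k * \<theta> * exp (\<omega> * t) \<le> norm (c k *\<^sub>R T t z + q)))"
      by (rule escaping_direction[OF esc less_imp_le[OF \<theta>(1)] \<theta>(2) \<sigma>_nonneg c])
    then obtain z where z: "norm z = 1" "\<forall>t\<in>{0..\<sigma> (Suc k)}. norm (T t z) \<le> 2 * exp (\<omega> * t) \<and>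
       (\<forall>q\<in>?Q. c k * \<theta> * exp (\<omega> * t) \<le> norm (c k *\<^sub>R T t z + q))"
      by (elim exE conjE)
    have "T t p + q \<in> ?Q" if "t \<in> {0..\<sigma> (Suc k)}" "q \<in> Q (\<sigma> (Suc k))" for t q
      using that by (intro image_eqI[of _ _ "(t, q)"]) auto
    with z(2) have "\<forall>t\<in>{0..\<sigma> (Suc k)}. norm (T t z) \<le> 2 * exp (\<omega> * t) \<and>
        (\<forall>q\<in>Q (\<sigma> (Suc k)). c k * \<theta> * exp (\<omega> * t) \<le> norm (c k *\<^sub>R T t z + (T t p + q)))"
      by (simp only: Ball_def) blast
    then show ?thesis unfolding P_def using z(1) by blast
  qed
  then obtain Z where Z: "\<And>k p. P k p (Z k p)" by metis
  define X where "X = rec_nat y (\<lambda>k p. p + c k *\<^sub>R Z k p)"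
  define w where "w k = c k *\<^sub>R Z k (X k)" for k
  have X: "X k = y + (\<Sum>i<k. w i)" for k
    by (induction k) (simp_all add: X_def w_def)
  have nw: "norm (w k) = c k" for k using Z[of k "X k"] c[of k] by (simp add: P_def w_def)
  have sw: "summable (\<lambda>i. norm (w (i + k)))" for k
    unfolding nw using c_sums[of k] by (rule sums_summable)
  have sw': "summable w" using summable_norm_cancel[OF sw[of 0, simplified]] .
  define x0 where "x0 = y + suminf w"
  have "norm (suminf w) \<le> (\<Sum>i. norm (w i))" using sw[of 0] by (intro summable_norm) simp
  also have "\<dots> = c0 * (1 / (1 - \<rho>))" unfolding nw using sums_unique[OF c_sums[of 0]] by (simp add: c_def)
  also have "\<dots> \<le> c0 * (1 + 2 * \<rho>)" using geo(1) c0 by (intro mult_left_mono) auto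
  also have "\<dots> \<le> r" using \<rho>(3) c0 by (simp add: field_simps)
  finally have x0: "x0 \<in> cball y r" by (simp add: x0_def dist_norm)

  have "a t * exp (\<omega> * t) \<le> norm (T t x0 + q)"
    if k: "\<sigma> k \<le> t" "t \<le> \<sigma> (Suc k)" and q: "q \<in> Q (\<sigma> (Suc k))" for k t q
  proof -
    let ?w = "exp (\<omega> * t)"
    define v where "v = (\<Sum>i. w (i + Suc k))"
    have t: "0 \<le> t" using k \<sigma>_nonneg[of k] by simp
    have split: "x0 = X k + w k + v"
      unfolding x0_def X v_def using suminf_split_initial_segment[OF sw', of "Suc k"] by simp
    have term_le: "norm (T t (w (i + Suc k))) \<le> 2 * ?w * c (i + Suc k)" for i
    proof -
      have "t \<in> {0..\<sigma> (Suc (i + Suc k))}"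
        using t k(2) \<sigma>_mono[of "Suc k" "Suc (i + Suc k)"] by simp
      then have "norm (T t (Z (i + Suc k) (X (i + Suc k)))) \<le> 2 * ?w"
        using Z[of "i + Suc k" "X (i + Suc k)"] unfolding P_def by blast
      then show ?thesis
        using c[of "i + Suc k"] by (simp add: w_def blinfun.scaleR_right mult.commute)
    qed
    have dom: "(\<lambda>i. 2 * ?w * c (i + Suc k)) sums (2 * ?w * (c (Suc k) * (1 / (1 - \<rho>))))"
      by (intro sums_mult c_sums)
    have sT: "summable (\<lambda>i. norm (T t (w (i + Suc k))))"
      using term_le by (intro summable_comparison_test'[OF sums_summable[OF dom], of 0]) auto
    have "T t v = (\<Sum>i. T t (w (i + Suc k)))"
      unfolding v_def
      by (rule bounded_linear.suminf[OF blinfun.bounded_linear_right])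
        (rule summable_norm_cancel[OF sw])
    then have "norm (T t v) \<le> (\<Sum>i. norm (T t (w (i + Suc k))))"
      using summable_norm[OF sT] by simp
    also have "\<dots> \<le> 2 * ?w * (c (Suc k) * (1 / (1 - \<rho>)))"
      using suminf_le[OF term_le sT sums_summable[OF dom]] sums_unique[OF dom] by simp
    also have "\<dots> \<le> 2 * ?w * (c (Suc k) * 2)"
      using geo(2) c[of "Suc k"] by (intro mult_left_mono) auto
    finally have tail: "norm (T t v) \<le> \<rho> ^ k * (4 * c0 * \<rho>) * ?w" by (simp add: c_def mult_ac)
    have main: "c k * \<theta> * ?w \<le> norm (T t (w k) + (T t (X k) + q))"
      using Z[of k "X k"] t k(2) q by (simp add: P_def w_def blinfun.scaleR_right)
    have "a t \<le> \<rho> ^ k * G"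
    proof -
      have "a t \<le> a (\<sigma> k)"
        using a(2) \<sigma>_nonneg[of k] k(1) by (auto simp: monotone_on_def)
      then show ?thesis using a\<sigma>[of k] by simp
    qed
    then have "a t * ?w \<le> \<rho> ^ k * G * ?w" by (intro mult_right_mono) auto
    also have "\<dots> = c k * \<theta> * ?w - \<rho> ^ k * (4 * c0 * \<rho>) * ?w"
      by (simp add: G_def c_def algebra_simps)
    also have "\<dots> \<le> norm (T t (w k) + (T t (X k) + q)) - norm (T t v)" using main tail by linarith
    also have "\<dots> \<le> norm (T t (w k) + (T t (X k) + q) + T t v)" by (rule norm_diff_ineq)
    also have "T t (w k) + (T t (X k) + q) + T t v = T t x0 + q"
      by (simp add: split blinfun.add_right algebra_simps)
    finally show ?thesis .
  qed
  moreover have "\<exists>k. \<sigma> k \<le> t \<and> t \<le> \<sigma> (Suc k)" if t: "t \<ge> t0" for t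
  proof -
    define n where "n = (LEAST n. t < \<sigma> n)"
    obtain m :: nat where "t < real m" using reals_Archimedean2 by blast
    then have "t < \<sigma> m" using \<sigma>_real[of m] by simp
    then have n: "t < \<sigma> n" unfolding n_def by (rule LeastI)
    then have "n \<noteq> 0" using t \<sigma>0 by (cases n) auto
    then obtain k where k: "n = Suc k" using not0_implies_Suc by blast
    then have "\<not> t < \<sigma> k" using not_less_Least[of k "\<lambda>n. t < \<sigma> n"] n_def by simp
    then show ?thesis using n k by (intro exI[of _ k]) simp
  qed
  ultimately show ?thesis using x0 by (intro bexI[of _ x0]) meson+
qed

end


section \<open>Unbounded resolvents on a vertical line\<close>

context closed_operator
begin

lemma resolvent_inverse:
  assumes "\<mu> \<in> resolvent_set D A"
  shows "resolvent D A \<mu> x \<in> D" "shifted \<mu> (resolvent D A \<mu> x) = x"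
    "z \<in> D \<Longrightarrow> resolvent D A \<mu> (shifted \<mu> z) = z" "bounded_linear (resolvent D A \<mu>)"
proof -
  have bij: "bij_betw (shifted \<mu>) D UNIV" and eq: "resolvent D A \<mu> = inv_into D (shifted \<mu>)"
    using assms by (simp_all add: resolvent_set_def resolvent_def shifted_def[abs_def])
  then have x: "x \<in> shifted \<mu> ` D" by (simp add: bij_betw_def)
  show "resolvent D A \<mu> x \<in> D" unfolding eq using x by (rule inv_into_into)
  show "shifted \<mu> (resolvent D A \<mu> x) = x" unfolding eq using x by (rule f_inv_into_f)
  show "resolvent D A \<mu> (shifted \<mu> z) = z" if "z \<in> D"
    unfolding eq using bij that by (intro inv_into_f_f) (auto simp: bij_betw_def)
  show "bounded_linear (resolvent D A \<mu>)" using assms by (simp add: resolvent_set_def)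
qed

lemma large_resolvent_eigenvector:
  assumes \<mu>: "\<mu> \<in> resolvent_set D A" and L: "0 < L" "L < onorm (resolvent D A \<mu>)"
  shows "\<exists>z\<in>D. norm z = 1 \<and> norm (shifted \<mu> z) < 1 / L"
proof -
  have "\<exists>x. L * norm x < norm (resolvent D A \<mu> x)"
  proof (rule ccontr)
    assume "\<not> ?thesis"
    then have "onorm (resolvent D A \<mu>) \<le> L" using L(1) by (intro onorm_bound) (auto simp: not_less)
    then show False using L(2) by simp
  qed
  then obtain x where x: "L * norm x < norm (resolvent D A \<mu> x)" by blast
  let ?n = "norm (resolvent D A \<mu> x)"
  define z where "z = (1 / ?n) *\<^sub>R resolvent D A \<mu> x"
  have n: "?n > 0" using x L(1) by (meson le_less_trans mult_nonneg_nonneg less_imp_le norm_ge_zero)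
  have "shifted \<mu> z = (1 / ?n) *\<^sub>R x"
    using resolvent_inverse[OF \<mu>] by (simp add: z_def shifted_scaleR)
  then have "norm (shifted \<mu> z) < 1 / L" using n x L(1) by (simp add: field_simps)
  moreover have "z \<in> D" "norm z = 1"
    using n resolvent_inverse(1)[OF \<mu>] by (auto simp: z_def dom_scaleR)
  ultimately show ?thesis by blast
qed

text \<open>Bounded imaginary parts would accumulate at some \<open>b\<close>, and the unit vectors below would then
  be approximate eigenvectors for a single point of the resolvent set.\<close>

lemma high_frequency_eigenvectors:
  assumes res: "\<And>b. Complex \<omega> b \<in> resolvent_set D A"
    and unbdd: "\<not> bdd_above (range (\<lambda>b. onorm (resolvent D A (Complex \<omega> b))))"
    and \<eta>: "\<eta> > 0"
  shows "\<exists>b z. \<bar>b\<bar> \<ge> N \<and> z \<in> D \<and> norm z = 1 \<and> norm (shifted (Complex \<omega> b) z) < \<eta>"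
proof (rule ccontr)
  assume contra: "\<not> ?thesis"
  have "\<exists>b. \<exists>z\<in>D. norm z = 1 \<and> norm (shifted (Complex \<omega> b) z) < 1 / real (Suc n)" for n
  proof -
    obtain b where "real (Suc n) < onorm (resolvent D A (Complex \<omega> b))"
      using unbdd unfolding bdd_above_def by (metis (mono_tags, lifting) imageE not_le)
    then show ?thesis using large_resolvent_eigenvector[OF res] by (metis of_nat_0_less_iff zero_less_Suc)
  qed
  then obtain b z where bz: "\<And>n. z n \<in> D" "\<And>n. norm (z n) = 1"
    "\<And>n. norm (shifted (Complex \<omega> (b n)) (z n)) < 1 / real (Suc n)"
    by metis
  obtain m :: nat where m: "1 / \<eta> < real m" using reals_Archimedean2 by blast
  have "\<bar>b (n + m)\<bar> \<le> N" for n
  proof -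
    have "1 / real (Suc (n + m)) \<le> \<eta>"
      using m \<eta> by (simp add: field_simps) (smt (verit) mult_nonneg_nonneg of_nat_0_le_iff)
    then show ?thesis using contra bz(1,2) bz(3)[of "n + m"] by (meson le_cases less_le_trans)
  qed
  then have "bounded (range (\<lambda>n. b (n + m)))" by (auto simp: bounded_iff)
  then obtain l s where s: "strict_mono (s :: nat \<Rightarrow> nat)" "((\<lambda>n. b (n + m)) \<circ> s) \<longlonglongrightarrow> l"
    using bounded_imp_convergent_subsequence by blast
  let ?z = "\<lambda>n. z (s n + m)" and ?b = "\<lambda>n. b (s n + m)" and ?R = "resolvent D A (Complex \<omega> l)"
  have "norm (shifted (Complex \<omega> l) (?z n)) \<le> 1 / real (Suc n) + \<bar>l - ?b n\<bar>" for n
  proof -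
    have "norm (shifted (Complex \<omega> l) (?z n))
        \<le> norm (shifted (Complex \<omega> (?b n)) (?z n)) + norm ((Complex \<omega> l - Complex \<omega> (?b n)) *\<^sub>C ?z n)"
      unfolding shifted_change[of "Complex \<omega> l" _ "Complex \<omega> (?b n)"] by (rule norm_triangle_ineq)
    moreover have "norm ((Complex \<omega> l - Complex \<omega> (?b n)) *\<^sub>C ?z n) = \<bar>l - ?b n\<bar>"
      by (simp add: norm_scaleC bz cmod_def)
    moreover have "1 / real (Suc (s n + m)) \<le> 1 / real (Suc n)"
      using seq_suble[OF s(1), of n] by (intro divide_left_mono) auto
    ultimately show ?thesis using bz(3)[of "s n + m"] by linarith
  qed
  then have "eventually (\<lambda>n. norm (shifted (Complex \<omega> l) (?z n)) \<le> 1 / real (Suc n) + \<bar>l - ?b n\<bar>) sequentially"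
    by simp
  moreover have "(\<lambda>n. 1 / real (Suc n) + \<bar>l - ?b n\<bar>) \<longlonglongrightarrow> 0 + \<bar>l - l\<bar>"
  proof (intro tendsto_add tendsto_rabs tendsto_diff tendsto_const)
    show "(\<lambda>n. 1 / real (Suc n)) \<longlonglongrightarrow> 0"
      using LIMSEQ_inverse_real_of_nat by (simp add: inverse_eq_divide)
    show "?b \<longlonglongrightarrow> l" using s(2) by (simp only: o_def)
  qed
  then have "(\<lambda>n. 1 / real (Suc n) + \<bar>l - ?b n\<bar>) \<longlonglongrightarrow> 0" by simp
  ultimately have "(\<lambda>n. shifted (Complex \<omega> l) (?z n)) \<longlonglongrightarrow> 0" by (rule Lim_null_comparison)
  then have "(\<lambda>n. ?R (shifted (Complex \<omega> l) (?z n))) \<longlonglongrightarrow> ?R 0"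
    by (rule bounded_linear.tendsto[OF resolvent_inverse(4)[OF res]])
  moreover have "?R 0 = 0"
    using resolvent_inverse(4)[OF res] by (rule linear_0[OF bounded_linear.linear])
  ultimately have "?z \<longlonglongrightarrow> 0" using resolvent_inverse(3)[OF res bz(1)] by simp
  then have "(\<lambda>n. norm (?z n)) \<longlonglongrightarrow> norm (0 :: 'a)" by (rule tendsto_norm)
  then show False using bz(2) by (simp add: LIMSEQ_const_iff)
qed

end

context locally_bounded_semigroup
begin

text \<open>At time \<open>h = \<pi> / \<bar>b\<bar>\<close> the orbit of an approximate eigenvector \<open>z\<close> for \<open>\<omega> + \<i> b\<close> is close to
  \<open>-z\<close>, whereas for large \<open>b\<close> the orbits starting in a compact set have hardly moved. So a point
  of the set within \<open>\<theta>\<close> of \<open>z\<close> is within about \<open>\<kappa> \<theta>\<close> of \<open>-z\<close>, and the two distances add up to at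
  least \<open>2\<close>.\<close>

lemma escaping_if_unbounded_resolvent:
  assumes res: "\<And>b. Complex \<omega> b \<in> resolvent_set D A"
    and unbdd: "\<not> bdd_above (range (\<lambda>b. onorm (resolvent D A (Complex \<omega> b))))"
    and \<kappa>: "eventually (\<lambda>t. norm (T t) \<le> \<kappa>) (at_right 0)" and \<theta>: "\<theta> * (1 + \<kappa>) < 2"
  shows "escaping_eigenvectors \<omega> \<theta>"
  unfolding escaping_eigenvectors_def
proof (intro allI impI)
  fix \<eta> :: real and M :: "'a set" assume \<eta>: "\<eta> > 0" and M: "compact M"
  define e where "e = (2 - \<theta> * (1 + \<kappa>)) / 3"
  have e: "e > 0" using \<theta> by (simp add: e_def)
  have "uniformly_continuous_on ({0..1} \<times> M) (\<lambda>(t, x). T t x)"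
    by (intro compact_uniformly_continuous continuous_on_subset[OF continuous_on_flow] compact_Times compact_Icc M)
      auto
  then obtain d where d: "d > 0" "\<And>p q. p \<in> {0..1} \<times> M \<Longrightarrow> q \<in> {0..1} \<times> M \<Longrightarrow> dist q p < d \<Longrightarrow>
      dist (case q of (t, x) \<Rightarrow> T t x) (case p of (t, x) \<Rightarrow> T t x) < e"
    using e unfolding uniformly_continuous_on_def by metis
  have still: "norm (T t m - m) \<le> e" if "m \<in> M" "0 \<le> t" "t \<le> 1" "t < d" for t m
    using d(2)[of "(0, m)" "(t, m)"] that by (simp add: T_0 dist_norm dist_Pair_Pair)
  have "((\<lambda>t. exp (\<omega> * t)) \<longlongrightarrow> exp (\<omega> * 0)) (at_right 0)" by (intro tendsto_intros)
  then have "eventually (\<lambda>t. dist (exp (\<omega> * t)) 1 < e) (at_right 0)" using e by (auto dest: tendstoD)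
  then have "eventually (\<lambda>t. norm (T t) \<le> \<kappa> \<and> dist (exp (\<omega> * t)) 1 < e) (at_right 0)"
    using \<kappa> by eventually_elim simp
  then obtain d' where d': "d' > 0"
    "\<And>t. 0 < t \<Longrightarrow> t < d' \<Longrightarrow> norm (T t) \<le> \<kappa> \<and> dist (exp (\<omega> * t)) 1 < e"
    unfolding eventually_at_right_field by auto
  obtain C where C: "C \<ge> 1" "\<And>s. 0 \<le> s \<Longrightarrow> s \<le> 1 \<Longrightarrow> norm (T s) \<le> C"
    using bounded_on_compact[of 1] by metis
  define G where "G = C * exp (2 * \<bar>\<omega>\<bar>)"
  have G: "G > 0" using C by (simp add: G_def)
  define \<delta> where "\<delta> = min 1 (min d d')"
  have \<delta>: "\<delta> > 0" "\<delta> \<le> 1" "\<delta> \<le> d" "\<delta> \<le> d'" using d(1) d'(1) by (auto simp: \<delta>_def)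
  have "min \<eta> (e / G) > 0" using \<eta> e G by simp
  from high_frequency_eigenvectors[OF res unbdd this]
  obtain b z where bz: "\<bar>b\<bar> \<ge> 2 * pi / \<delta>" "z \<in> D" "norm z = 1" "norm (shifted (Complex \<omega> b) z) < min \<eta> (e / G)"
    by blast
  have "2 * pi / \<delta> > 0" using \<delta>(1) by simp
  then have b: "\<bar>b\<bar> > 0" using bz(1) by linarith
  define h where "h = pi / \<bar>b\<bar>"
  have "h \<le> \<delta> / 2" using bz(1) b \<delta>(1) by (simp add: h_def field_simps)
  moreover have "0 < h" using b by (simp add: h_def)
  ultimately have h: "0 < h" "h < \<delta>" using \<delta>(1) by auto
  have "exp (Complex \<omega> b * complex_of_real h) = - complex_of_real (exp (\<omega> * h))"
  proof -
    have "b * h = pi \<or> b * h = - pi" using b by (auto simp: h_def abs_if)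
    then have "cis (b * h) = - 1" by (auto simp: complex_eq_iff)
    then show ?thesis by (simp add: exp_eq_polar exp_of_real)
  qed
  moreover have "norm (T h z - exp (Complex \<omega> b * complex_of_real h) *\<^sub>C z)
      \<le> G * norm (shifted (Complex \<omega> b) z)"
    using approximate_eigenvector_orbit[OF bz(2) C(2), where \<tau> = 1 and t = h and \<mu> = "Complex \<omega> b"] h \<delta> by (simp add: G_def)
  moreover have "G * norm (shifted (Complex \<omega> b) z) \<le> G * (e / G)" using bz(4) G by (intro mult_left_mono) auto
  ultimately have "norm (T h z + exp (\<omega> * h) *\<^sub>R z) \<le> e"
    using G by (simp add: scaleC.minus_left scaleC_of_real)
  moreover have "norm (z - exp (\<omega> * h) *\<^sub>R z) \<le> e"
  proof -
    have "z - exp (\<omega> * h) *\<^sub>R z = (1 - exp (\<omega> * h)) *\<^sub>R z" by (simp add: scaleR_left_diff_distrib)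
    then have "norm (z - exp (\<omega> * h) *\<^sub>R z) = dist (exp (\<omega> * h)) 1"
      using bz(3) by (simp add: dist_norm abs_minus_commute)
    then show ?thesis using d'(2)[of h] h \<delta> by simp
  qed
  ultimately have turn: "norm (z + T h z) \<le> 2 * e"
    using norm_triangle_ineq[of "T h z + exp (\<omega> * h) *\<^sub>R z" "z - exp (\<omega> * h) *\<^sub>R z"]
    by (simp add: algebra_simps)
  have "\<theta> \<le> norm (z - m)" if m: "m \<in> M" for m
  proof (rule ccontr)
    assume "\<not> ?thesis"
    then have zm: "norm (z - m) < \<theta>" by simp
    have \<kappa>h: "norm (T h) \<le> \<kappa>" using d'(2)[of h] h \<delta> by simp
    then have "norm (T h) * norm (z - m) \<le> \<kappa> * \<theta>"
      using zm order_trans[OF norm_ge_zero \<kappa>h] by (intro mult_mono \<kappa>h) auto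
    then have "norm (T h m - T h z) \<le> \<kappa> * \<theta>"
      using norm_blinfun[of "T h" "m - z"] by (simp add: blinfun.diff_right norm_minus_commute)
    moreover have "norm (m - T h m) \<le> e" using still[OF m, of h] h \<delta> by (simp add: norm_minus_commute)
    moreover have "2 *\<^sub>R z = (z - m) + ((z + T h z) + ((T h m - T h z) + (m - T h m)))"
      by (simp add: scaleR_2)
    ultimately have "norm (2 *\<^sub>R z) < \<theta> + (2 * e + (\<kappa> * \<theta> + e))"
      using zm turn by (smt (verit) norm_triangle_ineq)
    moreover have "3 * e = 2 - (\<theta> + \<kappa> * \<theta>)" unfolding e_def by (simp add: field_simps)
    moreover have "norm (2 *\<^sub>R z) = 2" using bz(3) by simp
    ultimately show False by linarith
  qed
  then show "\<exists>\<mu>. \<exists>z\<in>D. \<bar>Re \<mu> - \<omega>\<bar> < \<eta> \<and> norm z = 1 \<and> norm (shifted \<mu> z) < \<eta> \<and> (\<forall>m\<in>M. \<theta> \<le> norm (z - m))"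
    using bz \<eta> by (intro exI[of _ "Complex \<omega> b"] bexI[of _ z]) auto
qed

section \<open>The essential spectral bound\<close>

text \<open>The supremum of the real parts of all points with escaping eigenvectors need not be attained, but
  points close to it are good enough for a given time interval.\<close>

lemma escaping_at_essential_bound:
  assumes ne: "essential_bound D A \<noteq> -\<infinity>"
  obtains \<omega> where "essential_bound D A \<le> ereal \<omega>"
    "\<And>\<theta>. 0 < \<theta> \<Longrightarrow> \<theta> < 1 / 2 \<Longrightarrow> escaping_eigenvectors \<omega> \<theta>"
proof -
  define U where "U = {Re \<mu> |\<mu>. \<nexists>\<epsilon> \<theta> M. trapped \<mu> \<epsilon> \<theta> M}"
  have bdd: "bdd_above U"
  proof (rule bdd_aboveI[of _ "ln (norm (T 1) + 1)"])
    fix u assume "u \<in> U"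
    then have "exp u \<le> norm (T 1) + 1" using untrapped_Re_bounded by (auto simp: U_def)
    then show "u \<le> ln (norm (T 1) + 1)" by (simp add: ln_ge_iff add_nonneg_pos)
  qed
  have right: "\<exists>u\<in>U. Re \<mu> \<le> u" if \<mu>: "\<mu> \<in> essential_spectrum D A" for \<mu>
  proof -
    \<comment> \<open>at \<open>\<mu> + S\<close> the rescaled operator at time \<open>1\<close> is a strict contraction\<close>
    define S where "S = max 0 (ln (norm (T 1) + 1) - Re \<mu>)"
    have "Re \<mu> + S \<ge> ln (norm (T 1) + 1)" by (simp add: S_def)
    then have "exp (- (Re \<mu> + S)) \<le> exp (- ln (norm (T 1) + 1))" by simp
    also have "\<dots> = 1 / (norm (T 1) + 1)" by (simp add: exp_minus add_nonneg_pos inverse_eq_divide)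
    finally have "exp (- (Re \<mu> + S)) * norm (T 1) \<le> 1 / (norm (T 1) + 1) * norm (T 1)"
      by (rule mult_right_mono) simp
    also have "\<dots> < 1" by (simp add: divide_less_eq add_nonneg_pos)
    finally have "shifted (\<mu> + complex_of_real S) ` D = UNIV" by (intro range_shifted_UNIV) simp
    then obtain s where "s \<ge> 0" "\<nexists>\<epsilon> \<theta> M. trapped (\<mu> + complex_of_real s) \<epsilon> \<theta> M"
      using untrapped_right_of_essential_spectrum[OF \<mu>, of S] by (auto simp: S_def)
    then show ?thesis unfolding U_def by (intro bexI[of _ "Re \<mu> + s"]) (auto intro!: exI[of _ "\<mu> + complex_of_real s"])
  qed
  have "essential_spectrum D A \<noteq> {}" using ne by (auto simp: essential_bound_def bot_ereal_def)
  then have Une: "U \<noteq> {}" using right by blast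
  show thesis
  proof (rule that[of "Sup U"])
    show "essential_bound D A \<le> ereal (Sup U)"
      unfolding essential_bound_def
    proof (rule SUP_least)
      fix \<mu> assume "\<mu> \<in> essential_spectrum D A"
      then obtain u where "u \<in> U" "Re \<mu> \<le> u" using right by blast
      then show "ereal (Re \<mu>) \<le> ereal (Sup U)" using cSup_upper[OF _ bdd] by force
    qed
    show "escaping_eigenvectors (Sup U) \<theta>" if \<theta>: "0 < \<theta>" "\<theta> < 1 / 2" for \<theta>
      unfolding escaping_eigenvectors_def
    proof (intro allI impI)
      fix \<eta> :: real and M :: "'a set" assume \<eta>: "\<eta> > 0" and M: "compact M"
      obtain u where u: "u \<in> U" "Sup U - \<eta> < u" using less_cSupD[OF Une, of "Sup U - \<eta>"] \<eta> by auto
      then obtain \<mu> where \<mu>: "\<nexists>\<epsilon> \<theta> M. trapped \<mu> \<epsilon> \<theta> M" "u = Re \<mu>" by (auto simp: U_def)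
      have "u \<le> Sup U" using u(1) bdd by (rule cSup_upper)
      then have "\<bar>Re \<mu> - Sup U\<bar> < \<eta>" using u(2) \<mu>(2) \<eta> by simp
      then show "\<exists>\<mu>. \<exists>z\<in>D. \<bar>Re \<mu> - Sup U\<bar> < \<eta> \<and> norm z = 1 \<and> norm (shifted \<mu> z) < \<eta> \<and>
          (\<forall>m\<in>M. \<theta> \<le> norm (z - m))"
        using untrapped_escape[OF \<mu>(1) \<theta> \<eta> M] by blast
    qed
  qed
qed

lemma growing_mild_solution:
  assumes esc: "escaping_eigenvectors \<omega> \<theta>"
    and K: "continuous_on ({0..} \<times> UNIV) (\<lambda>(t, z). K t z)" "maps_bounded_to_precompact K"
    and sol: "\<And>x0. x0 \<in> B \<Longrightarrow> mild_solution T K x0 (u x0)"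
    and bd: "\<And>\<tau>. \<tau> > 0 \<Longrightarrow> bounded {u x0 t |t x0. 0 \<le> t \<and> t \<le> \<tau> \<and> x0 \<in> B}"
    and a: "\<And>t. t \<ge> 0 \<Longrightarrow> a t \<ge> 0" "antimono_on {0..} a" "(a \<longlongrightarrow> 0) at_top"
    and r: "r > 0" and t0: "t0 \<ge> 0" "a t0 < r * \<theta>" and B: "cball y r \<subseteq> B"
  shows "\<exists>x0\<in>cball y r. \<forall>t\<ge>t0. a t * exp (\<omega> * t) \<le> norm (u x0 t)"
proof -
  have "\<exists>Q. compact Q \<and> (\<forall>x0\<in>B. \<forall>t. 0 \<le> t \<longrightarrow> t \<le> \<tau> \<longrightarrow> (\<exists>q\<in>Q. u x0 t = T t x0 + q))" for \<tau>
  proof -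
    have "max \<tau> 1 > 0" by simp
    from mild_solution_compact_part[OF K sol bd[OF this]]
    obtain Q where "compact Q"
      "\<And>x0 t. x0 \<in> B \<Longrightarrow> 0 \<le> t \<Longrightarrow> t \<le> max \<tau> 1 \<Longrightarrow> \<exists>q\<in>Q. u x0 t = T t x0 + q" by blast
    then show ?thesis by (intro exI[of _ Q]) auto
  qed
  then obtain Q where Q: "\<And>\<tau>. compact (Q \<tau>)"
    "\<And>\<tau> x0 t. x0 \<in> B \<Longrightarrow> 0 \<le> t \<Longrightarrow> t \<le> \<tau> \<Longrightarrow> \<exists>q\<in>Q \<tau>. u x0 t = T t x0 + q" by metis
  have "\<exists>x0\<in>cball y r. \<forall>t\<ge>t0. \<exists>\<tau>\<ge>t. \<forall>q\<in>Q \<tau>. a t * exp (\<omega> * t) \<le> norm (T t x0 + q)"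
    by (rule growing_orbit[OF esc a r t0 Q(1)])
  then obtain x0 where x0: "x0 \<in> cball y r"
    "\<And>t. t \<ge> t0 \<Longrightarrow> \<exists>\<tau>\<ge>t. \<forall>q\<in>Q \<tau>. a t * exp (\<omega> * t) \<le> norm (T t x0 + q)"
    by blast
  have "a t * exp (\<omega> * t) \<le> norm (u x0 t)" if t: "t \<ge> t0" for t
  proof -
    obtain \<tau> where \<tau>: "\<tau> \<ge> t" "\<forall>q\<in>Q \<tau>. a t * exp (\<omega> * t) \<le> norm (T t x0 + q)" using x0(2)[OF t] by blast
    obtain q where "q \<in> Q \<tau>" "u x0 t = T t x0 + q"
      using Q(2)[of x0 t \<tau>] subsetD[OF B x0(1)] t t0(1) \<tau>(1) by auto
    then show ?thesis using \<tau>(2) by simp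
  qed
  then show ?thesis using x0(1) by blast
qed

end

section \<open>The growth theorem\<close>

text \<open>On a fixed nonzero vector the operators \<open>T t\<close> tend to the identity.\<close>

lemma semigroup_norm_Limsup_ge_1:
  fixes T :: "real \<Rightarrow> 'a::complex_banach \<Rightarrow>\<^sub>L 'a"
  assumes T: "C0_semigroup T" and nontrivial: "\<not> finite_dim (UNIV :: 'a set)"
  shows "1 \<le> Limsup (at_right 0) (\<lambda>t. ereal (norm (T t)))"
proof -
  have "\<exists>x :: 'a. x \<noteq> 0"
  proof (rule ccontr)
    assume "\<not> ?thesis"
    then have "complex_vector.span {} = (UNIV :: 'a set)" by auto
    then show False using nontrivial unfolding finite_dim_def by blast
  qed
  then obtain x :: 'a where x: "x \<noteq> 0" by blast
  have "((\<lambda>t. ereal (norm (T t x) / norm x)) \<longlongrightarrow> ereal (norm x / norm x)) (at_right 0)"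
    using T x by (intro tendsto_intros) (auto simp: C0_semigroup_def)
  then have "1 = Limsup (at_right 0) (\<lambda>t. ereal (norm (T t x) / norm x))"
    using x by (subst lim_imp_Limsup) (auto simp: one_ereal_def)
  also have "\<dots> \<le> Limsup (at_right 0) (\<lambda>t. ereal (norm (T t)))"
    using x norm_blinfun by (intro Limsup_mono always_eventually) (auto simp: divide_le_eq)
  finally show ?thesis .
qed

theorem theorem1p1:
  fixes A :: "'a::complex_banach \<Rightarrow> 'a" and D B :: "'a set"
    and T :: "real \<Rightarrow> 'a \<Rightarrow>\<^sub>L 'a"
    and \<alpha> :: ereal
    and K :: "real \<Rightarrow> 'a \<Rightarrow> 'a"
    and x :: "real \<Rightarrow> 'a \<Rightarrow> 'a"
    and a :: "real \<Rightarrow> real"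
    and r t0 :: real and y :: 'a
  assumes "\<not> finite_dim (UNIV :: 'a set)"
    and "generates D A T"
    and "\<alpha> = Limsup (at_right 0) (\<lambda>t. ereal (norm (T t)))"
    and "continuous_on ({0..} \<times> UNIV) (\<lambda>(t, z). K t z)"
    and "maps_bounded_to_precompact K"
    and "bounded B"
    and "\<And>x0. x0 \<in> B \<Longrightarrow> mild_solution T K x0 (\<lambda>t. x t x0)"
    and "\<And>\<tau>. \<tau> > 0 \<Longrightarrow> bounded {x t x0 |t x0. 0 \<le> t \<and> t \<le> \<tau> \<and> x0 \<in> B}"
    and "\<And>t. t \<ge> 0 \<Longrightarrow> a t \<ge> 0"
    and "antimono_on {0..} a"
    and "(a \<longlongrightarrow> 0) at_top"
    and "r > 0" and "y \<in> B" and "t0 \<ge> 0"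
    and "ereal (a t0) < ereal r / (2 * \<alpha>)"
    and "cball y r \<subseteq> B"
  shows "(\<forall>\<omega>::real.
            (\<forall>b::real. Complex \<omega> b \<in> resolvent_set D A) \<and>
            \<not> bdd_above (range (\<lambda>b::real. onorm (resolvent D A (Complex \<omega> b)))) \<longrightarrow>
            (\<exists>x0 u. x0 \<in> cball y r \<and> mild_solution T K x0 u \<and>
               (\<forall>t\<ge>t0. norm (u t) \<ge> a t * exp (\<omega> * t)))) \<and>
         (\<exists>x0 u. x0 \<in> cball y r \<and> mild_solution T K x0 u \<and>
            (\<forall>t\<ge>t0. norm (u t) \<ge> a t * exp_rate (essential_bound D A) t))"
proof -
  have at0: "0 \<le> a t0" using assms(9,14) by simp
  have "1 \<le> \<alpha>"
    using semigroup_norm_Limsup_ge_1[OF _ assms(1)] assms(2,3) by (simp add: generates_def)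
  \<comment> \<open>\<open>\<alpha> = \<infinity>\<close> would make \<open>r / (2 \<alpha>)\<close> equal to \<open>0\<close>; so the semigroup is bounded near \<open>0\<close>\<close>
  moreover have "\<alpha> \<noteq> \<infinity>" using assms(15) at0 by auto
  ultimately obtain \<alpha>' where \<alpha>': "\<alpha> = ereal \<alpha>'" "1 \<le> \<alpha>'" by (cases \<alpha>) auto
  have "eventually (\<lambda>t. ereal (norm (T t)) < ereal (\<alpha>' + 1)) (at_right 0)"
    using \<alpha>'(1) assms(3) by (intro Limsup_lessD) simp
  then have \<kappa>: "eventually (\<lambda>t. norm (T t) \<le> \<alpha>' + 1) (at_right 0)" by eventually_elim simp
  then obtain d where d: "d > 0" "\<And>t. 0 < t \<Longrightarrow> t < d \<Longrightarrow> norm (T t) \<le> \<alpha>' + 1"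
    unfolding eventually_at_right_field by auto
  have "norm (T 0) \<le> 1" using assms(2) by (simp add: generates_def C0_semigroup_def norm_blinfun_id_le)
  then have "norm (T t) \<le> \<alpha>' + 1" if "t \<in> {0..d / 2}" for t
    using d \<alpha>'(2) that by (cases "t = 0") auto
  then have "\<exists>\<delta>>0. \<exists>C. \<forall>t\<in>{0..\<delta>}. norm (T t) \<le> C"
    using d(1) half_gt_zero by blast
  then interpret locally_bounded_semigroup D A T
    using assms(2) by unfold_locales
  have "a t0 < r / (2 * \<alpha>')" using assms(15) \<alpha>' by simp
  then have "a t0 / r < 1 / (2 * \<alpha>')" using assms(12) \<alpha>'(2) by (simp add: field_simps)
  \<comment> \<open>\<open>1 \<le> \<alpha>\<close> gives \<open>\<theta> < 1 / 2\<close>, as the essential spectrum requires, and \<open>\<theta> (1 + \<kappa>) < 2\<close> for \<open>\<kappa> = \<alpha> + 1\<close>, as the unbounded resolvent does\<close>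
  then obtain \<theta> where \<theta>: "a t0 / r < \<theta>" "\<theta> < 1 / (2 * \<alpha>')" using dense by blast
  have \<theta>0: "0 < \<theta>" using \<theta>(1) at0 assms(12) by (meson divide_nonneg_pos le_less_trans)
  have at0\<theta>: "a t0 < r * \<theta>" using \<theta>(1) assms(12) by (simp add: field_simps)
  have \<theta>\<alpha>: "\<theta> * \<alpha>' < 1 / 2" using \<theta>(2) \<alpha>'(2) by (simp add: field_simps)
  have \<theta>half: "\<theta> < 1 / 2"
    using mult_left_mono[OF \<alpha>'(2), of \<theta>] \<theta>0 \<theta>\<alpha> unfolding mult_1_right by linarith
  have grow: "\<exists>x0 u. x0 \<in> cball y r \<and> mild_solution T K x0 u \<and> (\<forall>t\<ge>t0. a t * exp (\<omega> * t) \<le> norm (u t))"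
    if "escaping_eigenvectors \<omega> \<theta>" for \<omega>
    using growing_mild_solution[OF that assms(4,5,7,8,9,10,11,12,14) at0\<theta> assms(16)] assms(7,16) by blast
  show ?thesis
  proof (intro conjI allI impI)
    fix \<omega> :: real
    assume "(\<forall>b::real. Complex \<omega> b \<in> resolvent_set D A) \<and>
      \<not> bdd_above (range (\<lambda>b::real. onorm (resolvent D A (Complex \<omega> b))))"
    moreover have "\<theta> * (1 + (\<alpha>' + 1)) < 2" using \<theta>\<alpha> \<theta>half by (simp add: algebra_simps)
    ultimately have "escaping_eigenvectors \<omega> \<theta>"
      using \<kappa> by (intro escaping_if_unbounded_resolvent) auto
    then show "\<exists>x0 u. x0 \<in> cball y r \<and> mild_solution T K x0 u \<and> (\<forall>t\<ge>t0. norm (u t) \<ge> a t * exp (\<omega> * t))"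
      by (rule grow)
  next
    show "\<exists>x0 u. x0 \<in> cball y r \<and> mild_solution T K x0 u \<and>
        (\<forall>t\<ge>t0. norm (u t) \<ge> a t * exp_rate (essential_bound D A) t)"
    proof (cases "essential_bound D A = -\<infinity>")
      case True
      then show ?thesis
        using assms(7)[OF assms(13)] assms(12)
        by (intro exI[of _ y] exI[of _ "\<lambda>t. x t y"]) (simp add: exp_rate_def)
    next
      case False
      then obtain \<omega> where \<omega>: "essential_bound D A \<le> ereal \<omega>" "escaping_eigenvectors \<omega> \<theta>"
        using escaping_at_essential_bound[OF False] \<theta>0 \<theta>half by metis
      have "real_of_ereal (essential_bound D A) \<le> \<omega>"
        using \<omega>(1) False by (cases "essential_bound D A") auto
      then have "exp_rate (essential_bound D A) t \<le> exp (\<omega> * t)" if "t \<ge> t0" for t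
        using that assms(14) False by (simp add: exp_rate_def mult_right_mono)
      then have rate: "a t * exp_rate (essential_bound D A) t \<le> a t * exp (\<omega> * t)" if "t \<ge> t0" for t
        using that assms(9)[of t] assms(14) by (simp add: mult_left_mono)
      obtain x0 u where xu: "x0 \<in> cball y r" "mild_solution T K x0 u"
        "\<forall>t\<ge>t0. a t * exp (\<omega> * t) \<le> norm (u t)"
        using grow[OF \<omega>(2)] by blast
      have "\<forall>t\<ge>t0. a t * exp_rate (essential_bound D A) t \<le> norm (u t)"
        using rate xu(3) order_trans by blast
      then show ?thesis using xu(1,2) by blast
    qed
  qed
qed

end
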